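(* Let $N\ge1$, let $q\in\mathbb{C}^\ast$ be not a root of unity, let $V=\mathbb{C}^{N+1}$ be the fundamental representation of $\mathcal{U}_q\mathfrak{sl}_{N+1}$, and let $c$ be the braiding $q^{-1}R_\rho$ on $V$. For any $A\in\mathrm{End}(V)$, the q-trace $\mathrm{Tr}_qA$ and the quantum trace $\mathrm{tr}_q(A)$ are related by $$\mathrm{Tr}_q A=q^{-N}\,\mathrm{tr}_q(A).$$
   Context: Let $e_1,\ldots,e_{N+1}$ be the standard basis of $V=\mathbb{C}^{N+1}$ and $E_{ij}$ the matrix units. The fundamental representation $\rho:\mathcal{U}_q\mathfrak{sl}_{N+1}\to\mathrm{End}\,V$ is $E_i\mapsto E_{i,i+1}$, $F_i\mapsto E_{i+1,i}$, $K_i\mapsto\sum_{l\ne i,i+1}E_{ll}+qE_{ii}+q^{-1}E_{i+1,i+1}$. The $R$-matrix acts on $V\otimes V$ by $R_\rho=q\sum_iE_{ii}\otimes E_{ii}+\sum_{i\ne j}E_{ij}\otimes E_{ji}+(q-q^{-1})\sum_{i<j}E_{jj}\otimes E_{ii}$, and $c=q^{-1}R_\rho$, i.e. $c(e_i\otimes e_i)=e_i\otimes e_i$; $c(e_i\otimes e_j)=q^{-1}e_j\otimes e_i$ for $i<j$; $c(e_i\otimes e_j)=q^{-1}e_j\otimes e_i+(1-q^{-2})e_i\otimes e_j$ for $i>j$. It is a braiding with $(c-\mathrm{id})(c+q^{-2}\mathrm{id})=0$, so $-c$ is of Hecke type with parameter $\nu=q^{-2}$. The quantum exterior algebra $\bigwedge_c(V)=T(V)/(\mathrm{Ker}(\mathrm{id}-c))$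 is the graded algebra generated by $e_1,\ldots,e_{N+1}$ with relations $e_i\wedge e_i=0$, $e_j\wedge e_i=-q^{-1}e_i\wedge e_j$ ($i<j$); $\bigwedge_c^p(V)$ is its degree-$p$ component, with basis $e_{i_1}\wedge\cdots\wedge e_{i_p}$, $1\le i_1<\cdots<i_p\le N+1$; $\bigwedge_c^1(V)=V$ and $\dim\bigwedge_c^{N+1}(V)=1$. It is identified with the quantum symmetric algebra of $(V,-c)$ (the element $e_{i_1}\wedge\cdots\wedge e_{i_p}$ corresponding to $\sum_{w\in\mathfrak{S}_p}T_w^{-c}(e_{i_1}\otimes\cdots\otimes e_{i_p})$, where $T_w^{-c}$ is the lift of $w$ to the braid group acting through $-c$); the quantum shuffle product becomes $\wedge$ and the deconcatenation coproduct becomes, for $i_1<\cdots<i_m$, $$\delta_{t,m-t}(e_{i_1}\wedge\cdots\wedge e_{i_m})=\sum_{w\in\mathfrak{S}_{t,m-t}}(-q)^{-l(w)}e_{i_{w(1)}}\wedge\cdots\wedge e_{i_{w(t)}}\otimes e_{i_{w(t+1)}}\wedge\cdots\wedge e_{i_{w(m)}},$$ where $\mathfrak{S}_{t,m-t}$ is the set of $w\in\mathfrak{S}_m$ increasing on $\{1,\ldots,t\}$ and on $\{t+1,\ldots,m\}$, and $l$ is the length. Convolution: for $A\in\mathrm{End}\bigwedge_c^i(V)$, $B\in\mathrm{End}\bigwedge_c^j(V)$, $A\ast B=\wedge\circ(A\otimes B)\circ\delta_{i,j}\in\mathrm{End}\bigwedge_c^{i+j}(V)$. With $\mathrm{I}_m$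 the identity of $\bigwedge_c^m(V)$, the q-trace of $A\in\mathrm{End}(V)=\mathrm{End}\bigwedge_c^1(V)$ is the unique scalar $\mathrm{Tr}_qA$ with $A\ast\mathrm{I}_{N}=(\mathrm{Tr}_qA)\,\mathrm{I}_{N+1}$. Quantum trace: let $K=K_1^{N}K_2^{2(N-1)}\cdots K_N^{N}=\prod_{i=1}^NK_i^{i(N+1-i)}$. Then $\mathrm{tr}_q(A)=\mathrm{Tr}(\rho(K)A)$, where $\mathrm{Tr}$ is the usual trace. *)

theory Defs
  imports
    "HOL-Library.Poly_Mapping"
    "HOL-Combinatorics.Permutations"
    "HOL-Algebra.QuotRing"
    "Jordan_Normal_Form.Matrix"
begin

text \<open>Conventions. The basis vectors of \<open>V\<close> are numbered from 0, as matrix and vector indices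
  are in \<^theory>\<open>Jordan_Normal_Form.Matrix\<close>: the letter \<open>i \<in> {..N}\<close> stands for
  \<open>e_{i+1}\<close>. The generators of the quantum group keep their numbers \<open>1, \<dots>, N\<close>.\<close>


section \<open>The fundamental representation and the braiding\<close>

definition munit :: "nat \<Rightarrow> nat \<Rightarrow> nat \<Rightarrow> complex mat" where
  "munit N i j = mat (N + 1) (N + 1) (\<lambda>(r, s). if r = i \<and> s = j then 1 else 0)"

datatype Uq_gen = UE nat | UF nat | UK nat | UKinv nat

text \<open>With vectors numbered from 0, the matrix unit \<open>E_{i,i+1}\<close> is \<open>munit N (i - 1) i\<close>.\<close>

fun rho_gen :: "nat \<Rightarrow> complex \<Rightarrow> Uq_gen \<Rightarrow> complex mat" where
  "rho_gen N q (UE i) = munit N (i - 1) i"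
| "rho_gen N q (UF i) = munit N i (i - 1)"
| "rho_gen N q (UK i) = mat_diag (N + 1) (\<lambda>l. if l = i - 1 then q else if l = i then inverse q else 1)"
| "rho_gen N q (UKinv i) = mat_diag (N + 1) (\<lambda>l. if l = i - 1 then inverse q else if l = i then q else 1)"

text \<open>The representation on monomials, a monomial in the generators being given by the list of
  its factors.\<close>

definition rho :: "nat \<Rightarrow> complex \<Rightarrow> Uq_gen list \<Rightarrow> complex mat" where
  "rho N q u = foldr (\<lambda>g M. rho_gen N q g * M) u (1\<^sub>m (N + 1))"

definition K_elem :: "nat \<Rightarrow> Uq_gen list" where
  "K_elem N = concat (map (\<lambda>i. replicate (i * (N + 1 - i)) (UK i)) [1..<N + 1])"

definition mat_trace :: "complex mat \<Rightarrow> complex" where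
  "mat_trace M = (\<Sum>i<dim_row M. M $$ (i, i))"

definition quantum_trace :: "nat \<Rightarrow> complex \<Rightarrow> complex mat \<Rightarrow> complex" where
  "quantum_trace N q A = mat_trace (rho N q (K_elem N) * A)"

text \<open>The tensor algebra of \<open>V\<close> is the free algebra on the letters: finitely supported functions
  on words, with the convolution product of \<^theory>\<open>HOL-Library.Poly_Mapping\<close> for the
  concatenation of words.\<close>

instantiation list :: (type) monoid_add
begin
definition zero_list :: "'a list" where "zero_list = []"
definition plus_list :: "'a list \<Rightarrow> 'a list \<Rightarrow> 'a list" where "plus_list = (@)"
instance by standard (simp_all add: zero_list_def plus_list_def)
end

type_synonym tensor = "nat list \<Rightarrow>\<^sub>0 complex"

definition pscale :: "complex \<Rightarrow> ('a \<Rightarrow>\<^sub>0 complex) \<Rightarrow> ('a \<Rightarrow>\<^sub>0 complex)" where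
  "pscale s x = Poly_Mapping.map ((*) s) x"

lemma lookup_pscale [simp]: "Poly_Mapping.lookup (pscale s x) w = s * Poly_Mapping.lookup x w"
  by (simp add: pscale_def map.rep_eq when_def)

interpretation pscale: Modules.module pscale
  by standard (rule poly_mapping_eqI; simp add: lookup_add algebra_simps)+

definition tensor_deg :: "nat \<Rightarrow> nat \<Rightarrow> tensor set" where
  "tensor_deg N m = {x. \<forall>w\<in>Poly_Mapping.keys x. length w = m \<and> set w \<subseteq> {..N}}"

definition tensor_algebra :: "nat \<Rightarrow> tensor ring" where
  "tensor_algebra N =
    \<lparr>carrier = {x. \<forall>w\<in>Poly_Mapping.keys x. set w \<subseteq> {..N}}, monoid.mult = (*), one = 1, zero = 0, add = (+)\<rparr>"

text \<open>The operator \<open>A \<otimes> B\<close> on \<open>V \<otimes> V\<close>, the span of the words of length 2.\<close>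

definition tensor_op :: "nat \<Rightarrow> complex mat \<Rightarrow> complex mat \<Rightarrow> tensor \<Rightarrow> tensor" where
  "tensor_op N A B x =
    (\<Sum>i\<le>N. \<Sum>j\<le>N. \<Sum>k\<le>N. \<Sum>l\<le>N.
      Poly_Mapping.single [k, l] (A $$ (k, i) * B $$ (l, j) * Poly_Mapping.lookup x [i, j]))"

definition R_rho :: "nat \<Rightarrow> complex \<Rightarrow> tensor \<Rightarrow> tensor" where
  "R_rho N q x =
    pscale q (\<Sum>i\<le>N. tensor_op N (munit N i i) (munit N i i) x)
    + (\<Sum>(i, j) | i \<le> N \<and> j \<le> N \<and> i \<noteq> j. tensor_op N (munit N i j) (munit N j i) x)
    + pscale (q - inverse q)
        (\<Sum>(i, j) | i \<le> N \<and> j \<le> N \<and> i < j. tensor_op N (munit N j j) (munit N i i) x)"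

definition braiding :: "nat \<Rightarrow> complex \<Rightarrow> tensor \<Rightarrow> tensor" where
  "braiding N q x = pscale (inverse q) (R_rho N q x)"


section \<open>The quantum exterior algebra\<close>

definition ext_ideal :: "nat \<Rightarrow> complex \<Rightarrow> tensor set" where
  "ext_ideal N q = genideal (tensor_algebra N) {x \<in> tensor_deg N 2. x - braiding N q x = 0}"

definition ext_algebra :: "nat \<Rightarrow> complex \<Rightarrow> tensor set ring" where
  "ext_algebra N q = tensor_algebra N Quot ext_ideal N q"

definition ext_class :: "nat \<Rightarrow> complex \<Rightarrow> tensor \<Rightarrow> tensor set" where
  "ext_class N q x = ext_ideal N q +>\<^bsub>tensor_algebra N\<^esub> x"

definition ext_deg :: "nat \<Rightarrow> complex \<Rightarrow> nat \<Rightarrow> tensor set set" where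
  "ext_deg N q m = ext_class N q ` tensor_deg N m"

definition ext_smult :: "nat \<Rightarrow> complex \<Rightarrow> complex \<Rightarrow> tensor set \<Rightarrow> tensor set" where
  "ext_smult N q s X = ext_class N q (Poly_Mapping.single [] s) \<otimes>\<^bsub>ext_algebra N q\<^esub> X"

text \<open>The class of the word \<open>[i_1, \<dots>, i_m]\<close> is the product of its letters in the quotient.\<close>

definition ext_word :: "nat \<Rightarrow> complex \<Rightarrow> nat list \<Rightarrow> tensor set" where
  "ext_word N q w = ext_class N q (Poly_Mapping.single w 1)"

definition basis_words :: "nat \<Rightarrow> nat \<Rightarrow> nat list set" where
  "basis_words N m = {w. length w = m \<and> set w \<subseteq> {..N} \<and> sorted_wrt (<) w}"

text \<open>The representative of a homogeneous element that is a combination of increasing words; its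
  coefficients are the coordinates in the basis \<open>e_{i_1} \<and> \<dots> \<and> e_{i_m}\<close>.\<close>

definition normal_form :: "nat \<Rightarrow> complex \<Rightarrow> nat \<Rightarrow> tensor set \<Rightarrow> tensor" where
  "normal_form N q m X =
    (THE x. Poly_Mapping.keys x \<subseteq> basis_words N m \<and> ext_class N q x = X)"


section \<open>Tensor products of homogeneous components\<close>

text \<open>The tensor product of the components of degrees \<open>i\<close> and \<open>j\<close> is the free vector space on
  pairs modulo the span of the bilinearity relations. Its elements are the classes of formal
  combinations of pairs, and maps out of it are evaluated on representatives.\<close>

type_synonym formal = "(tensor set \<times> tensor set) \<Rightarrow>\<^sub>0 complex"

definition bilinear_relations :: "nat \<Rightarrow> complex \<Rightarrow> nat \<Rightarrow> nat \<Rightarrow> formal set" where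
  "bilinear_relations N q i j =
    {Poly_Mapping.single (X \<oplus>\<^bsub>ext_algebra N q\<^esub> X', Y) 1
       - Poly_Mapping.single (X, Y) 1 - Poly_Mapping.single (X', Y) 1 | X X' Y.
       X \<in> ext_deg N q i \<and> X' \<in> ext_deg N q i \<and> Y \<in> ext_deg N q j}
    \<union> {Poly_Mapping.single (X, Y \<oplus>\<^bsub>ext_algebra N q\<^esub> Y') 1
       - Poly_Mapping.single (X, Y) 1 - Poly_Mapping.single (X, Y') 1 | X Y Y'.
       X \<in> ext_deg N q i \<and> Y \<in> ext_deg N q j \<and> Y' \<in> ext_deg N q j}
    \<union> {Poly_Mapping.single (ext_smult N q s X, Y) 1 - Poly_Mapping.single (X, Y) s | s X Y.
       X \<in> ext_deg N q i \<and> Y \<in> ext_deg N q j}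
    \<union> {Poly_Mapping.single (X, ext_smult N q s Y) 1 - Poly_Mapping.single (X, Y) s | s X Y.
       X \<in> ext_deg N q i \<and> Y \<in> ext_deg N q j}"

definition tensor_class :: "nat \<Rightarrow> complex \<Rightarrow> nat \<Rightarrow> nat \<Rightarrow> formal \<Rightarrow> formal set" where
  "tensor_class N q i j \<phi> =
    {\<psi>. Poly_Mapping.keys \<psi> \<subseteq> ext_deg N q i \<times> ext_deg N q j
        \<and> \<phi> - \<psi> \<in> pscale.span (bilinear_relations N q i j)}"

definition tensor_map :: "nat \<Rightarrow> complex \<Rightarrow> nat \<Rightarrow> nat \<Rightarrow>
    (tensor set \<Rightarrow> tensor set) \<Rightarrow> (tensor set \<Rightarrow> tensor set) \<Rightarrow> formal set \<Rightarrow> formal set" where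
  "tensor_map N q i j f g \<Phi> = the_elem
    ((\<lambda>\<phi>. tensor_class N q i j
        (\<Sum>(X, Y)\<in>Poly_Mapping.keys \<phi>.
          Poly_Mapping.single (f X, g Y) (Poly_Mapping.lookup \<phi> (X, Y)))) ` \<Phi>)"

definition wedge_map :: "nat \<Rightarrow> complex \<Rightarrow> formal set \<Rightarrow> tensor set" where
  "wedge_map N q \<Phi> = the_elem
    ((\<lambda>\<phi>. finsum (ext_algebra N q)
        (\<lambda>(X, Y). ext_smult N q (Poly_Mapping.lookup \<phi> (X, Y)) (X \<otimes>\<^bsub>ext_algebra N q\<^esub> Y))
        (Poly_Mapping.keys \<phi>)) ` \<Phi>)"


section \<open>Coproduct, convolution and the q-trace\<close>

text \<open>Permutations act on the positions \<open>0, \<dots>, i + j - 1\<close>.\<close>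

definition shuffle_perms :: "nat \<Rightarrow> nat \<Rightarrow> (nat \<Rightarrow> nat) set" where
  "shuffle_perms i j =
    {w. w permutes {..<i + j} \<and> strict_mono_on {..<i} w \<and> strict_mono_on {i..<i + j} w}"

definition perm_length :: "nat \<Rightarrow> (nat \<Rightarrow> nat) \<Rightarrow> nat" where
  "perm_length m w = card {(a, b). a < b \<and> b < m \<and> w b < w a}"

text \<open>The coproduct is deconcatenation on the quantum symmetric algebra of \<open>(V, -c)\<close>, transported
  to the quantum exterior algebra: it is linear, and given on the basis by a signed sum over
  shuffles.\<close>

definition coproduct :: "nat \<Rightarrow> complex \<Rightarrow> nat \<Rightarrow> nat \<Rightarrow> tensor set \<Rightarrow> formal set" where
  "coproduct N q i j X =
    (let x = normal_form N q (i + j) X in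
     tensor_class N q i j
       (\<Sum>v\<in>Poly_Mapping.keys x. \<Sum>w\<in>shuffle_perms i j.
         Poly_Mapping.single
           (ext_word N q (map (\<lambda>a. v ! w a) [0..<i]), ext_word N q (map (\<lambda>a. v ! w a) [i..<i + j]))
           (Poly_Mapping.lookup x v * (- q) powi (- int (perm_length (i + j) w)))))"

text \<open>Endomorphisms of a component are functions restricted to that component, so that equality
  of endomorphisms is equality of functions.\<close>

definition convolution :: "nat \<Rightarrow> complex \<Rightarrow> nat \<Rightarrow> nat \<Rightarrow>
    (tensor set \<Rightarrow> tensor set) \<Rightarrow> (tensor set \<Rightarrow> tensor set) \<Rightarrow> tensor set \<Rightarrow> tensor set" where
  "convolution N q i j f g =
    (\<lambda>X\<in>ext_deg N q (i + j). wedge_map N q (tensor_map N q i j f g (coproduct N q i j X)))"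

definition ext_id :: "nat \<Rightarrow> complex \<Rightarrow> nat \<Rightarrow> tensor set \<Rightarrow> tensor set" where
  "ext_id N q m = (\<lambda>X\<in>ext_deg N q m. X)"

text \<open>The identification of \<open>V\<close> with the component of degree 1, and the endomorphism of that
  component corresponding to an endomorphism of \<open>V\<close>.\<close>

definition embed_V :: "nat \<Rightarrow> complex \<Rightarrow> complex vec \<Rightarrow> tensor set" where
  "embed_V N q v = ext_class N q (\<Sum>i\<le>N. Poly_Mapping.single [i] (v $ i))"

definition ext_end1 :: "nat \<Rightarrow> complex \<Rightarrow> complex mat \<Rightarrow> tensor set \<Rightarrow> tensor set" where
  "ext_end1 N q A =
    (\<lambda>X\<in>ext_deg N q 1. embed_V N q (A *\<^sub>v the_inv_into (carrier_vec (N + 1)) (embed_V N q) X))"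

definition q_trace :: "nat \<Rightarrow> complex \<Rightarrow> complex mat \<Rightarrow> complex" where
  "q_trace N q A =
    (THE t. convolution N q 1 N (ext_end1 N q A) (ext_id N q N)
          = (\<lambda>X\<in>ext_deg N q (N + 1). ext_smult N q t (ext_id N q (N + 1) X)))"

end

theory Submission
  imports Defs
begin

text \<open>Every word straightens to the increasing word with the same letters, with coefficient
  \<open>(-q)\<^sup>-\<^sup>l\<close> for \<open>l\<close> inversions and 0 in case of a repeated letter. The linear map so defined is
  the identity modulo the ideal of relations and vanishes on that ideal, so that two tensors have
  the same class if and only if they straighten to the same tensor; this yields the basis of increasing
  words. On the top component, \<open>\<delta>\<close> splits off each letter \<open>k\<close> with coefficient \<open>(-q)\<^sup>-\<^sup>k\<close>; after
  applying \<open>A\<close>, only the diagonal entry survives the wedge product with the remaining letters, and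
  moving \<open>k\<close> back to its place contributes another \<open>(-q)\<^sup>-\<^sup>k\<close>. So the q-trace is the
  sum of the \<open>q\<^sup>-\<^sup>2\<^sup>k A\<^sub>k\<^sub>k\<close>, while \<open>\<rho>(K)\<close> is diagonal with entries \<open>q\<^sup>N\<^sup>-\<^sup>2\<^sup>k\<close>.\<close>

section \<open>Linear extension\<close>

text \<open>The linear map sending the basis vector \<open>Poly_Mapping.single k 1\<close> to
  \<open>h k\<close>. The maps \<open>straighten\<close>, \<open>wedge_lift\<close> and
  \<open>tensor_lift\<close> are all of this form, so one interpretation of
  \<open>module_hom\<close> gives the linearity of each.\<close>

definition linext :: "('a \<Rightarrow> 'b \<Rightarrow>\<^sub>0 complex) \<Rightarrow> ('a \<Rightarrow>\<^sub>0 complex) \<Rightarrow> 'b \<Rightarrow>\<^sub>0 complex" where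
  "linext h x = (\<Sum>k\<in>Poly_Mapping.keys x. pscale (Poly_Mapping.lookup x k) (h k))"

text \<open>The support of a sum can be smaller than the union of the supports; summing over a
  common finite set makes additivity a termwise matter.\<close>

lemma linext_superset:
  assumes "finite K" "Poly_Mapping.keys x \<subseteq> K"
  shows "linext h x = (\<Sum>k\<in>K. pscale (Poly_Mapping.lookup x k) (h k))"
  unfolding linext_def
  by (rule sum.mono_neutral_left) (use assms in \<open>auto simp: in_keys_iff\<close>)

lemma module_hom_linext: "module_hom pscale pscale (linext h)"
proof (unfold_locales)
  fix x y :: "'a \<Rightarrow>\<^sub>0 complex"
  let ?K = "Poly_Mapping.keys x \<union> Poly_Mapping.keys y"
  show "linext h (x + y) = linext h x + linext h y"
    using Poly_Mapping.keys_add[of x y]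
    by (simp add: linext_superset[of ?K] lookup_add pscale.scale_left_distrib sum.distrib)
next
  fix c and x :: "'a \<Rightarrow>\<^sub>0 complex"
  have "Poly_Mapping.keys (pscale c x) \<subseteq> Poly_Mapping.keys x"
    by (auto simp: in_keys_iff)
  then show "linext h (pscale c x) = pscale c (linext h x)"
    by (simp add: linext_superset[of "Poly_Mapping.keys x"] pscale.scale_sum_right)
qed

interpretation linext: module_hom pscale pscale "linext h" for h
  by (rule module_hom_linext)

lemma linext_single [simp]: "linext h (Poly_Mapping.single k c) = pscale c (h k)"
  by (simp add: linext_def)

lemma pscale_single [simp]: "pscale s (Poly_Mapping.single k c) = Poly_Mapping.single k (s * c)"
  by (rule poly_mapping_eqI) (simp add: lookup_single when_def)

text \<open>The expansion of \<open>x\<close> in the basis of single keys; it reduces linear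
  identities in \<open>x\<close> to identities between words.\<close>

lemma linext_id: "linext (\<lambda>k. Poly_Mapping.single k 1) x = x"
  by (rule poly_mapping_eqI)
    (auto simp: linext_def lookup_sum lookup_single when_def in_keys_iff)

lemma pscale_conv_mult: "pscale s (x :: tensor) = Poly_Mapping.single [] s * x"
proof -
  have "pscale s (linext (\<lambda>k. Poly_Mapping.single k 1) x)
      = Poly_Mapping.single [] s * linext (\<lambda>k. Poly_Mapping.single k 1) x"
    by (simp add: linext_def pscale.scale_sum_right sum_distrib_left mult_single plus_list_def)
  then show ?thesis by (simp only: linext_id)
qed

lemma pscale_mult_left: "pscale s (x :: tensor) * y = pscale s (x * y)"
  by (simp add: pscale_conv_mult mult.assoc)

text \<open>Scalars are embedded as multiples of the empty word, which commutes with every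
  word.\<close>

lemma single_mult_central: "x * Poly_Mapping.single [] s = Poly_Mapping.single [] s * (x :: tensor)"
proof -
  let ?e = "linext (\<lambda>k. Poly_Mapping.single k 1) x"
  have "?e * Poly_Mapping.single [] s = Poly_Mapping.single [] s * ?e"
    by (simp add: linext_def sum_distrib_left sum_distrib_right mult_single plus_list_def mult.commute)
  then show ?thesis by (simp only: linext_id)
qed

lemma pscale_mult_right: "x * pscale s (y :: tensor) = pscale s (x * y)"
  by (simp add: pscale_conv_mult mult.assoc[symmetric] single_mult_central)

lemma single_word_mult: "Poly_Mapping.single u a * Poly_Mapping.single v b
    = Poly_Mapping.single (u @ v) (a * b :: complex)"
  by (simp add: mult_single plus_list_def)

section \<open>Straightening of words\<close>

text \<open>The comparison is strict, so a weakly increasing word has no inversions even when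
  letters repeat.\<close>

fun word_inversions :: "'a :: linorder list \<Rightarrow> nat" where
  "word_inversions [] = 0"
| "word_inversions (x # xs) = length (filter (\<lambda>y. y < x) xs) + word_inversions xs"

text \<open>Only the comparison between the two exchanged letters changes; every other pair of
  letters keeps its order.\<close>

lemma word_inversions_swap:
  "k < l \<Longrightarrow> word_inversions (u @ [l, k] @ v) = Suc (word_inversions (u @ [k, l] @ v))"
  by (induction u) auto

lemma word_inversions_sorted: "sorted xs \<Longrightarrow> word_inversions xs = 0"
  by (induction xs) (auto simp: filter_empty_conv not_less)

text \<open>By transitivity, a word whose neighbours all increase is strictly increasing. The
  conclusion \<open>\<not> k < l\<close> covers both patterns that the relations can rewrite: a
  square and a descent.\<close>

lemma adjacent_descent:
  "\<not> sorted_wrt (<) w \<Longrightarrow> \<exists>u k l v. w = u @ [k, l] @ v \<and> \<not> k < (l :: 'a :: linorder)"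
proof (induction w rule: induct_list012)
  case (3 x y zs)
  show ?case
  proof (cases "x < y")
    case True
    with 3 have "\<not> sorted_wrt (<) (y # zs)"
      by (auto intro: order.strict_trans)
    with 3 obtain u k l v where "y # zs = u @ [k, l] @ v" "\<not> k < l"
      by blast
    then have "x # y # zs = (x # u) @ [k, l] @ v" "\<not> k < l" by simp_all
    then show ?thesis by blast
  next
    case False
    then have "x # y # zs = [] @ [x, y] @ zs \<and> \<not> x < y" by simp
    then show ?thesis by blast
  qed
qed auto

lemma sort_swap: "sort (u @ [l, k] @ v) = sort (u @ [k, l] @ v)"
  by (rule properties_for_sort) auto

definition word_sign :: "complex \<Rightarrow> nat list \<Rightarrow> complex" where
  "word_sign q w = (if distinct w then (- inverse q) ^ word_inversions w else 0)"

lemma word_sign_swap: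
  "k < l \<Longrightarrow> word_sign q (u @ [l, k] @ v) = - inverse q * word_sign q (u @ [k, l] @ v)"
  using word_inversions_swap[of k l u v] by (auto simp: word_sign_def)

definition straighten :: "complex \<Rightarrow> tensor \<Rightarrow> tensor" where
  "straighten q = linext (\<lambda>w. Poly_Mapping.single (sort w) (word_sign q w))"

section \<open>The relations\<close>

lemma lookup_tensor_op:
  assumes "k \<le> N" "l \<le> N"
  shows "Poly_Mapping.lookup (tensor_op N A B x) [k, l]
    = (\<Sum>i\<le>N. \<Sum>j\<le>N. A $$ (k, i) * B $$ (l, j) * Poly_Mapping.lookup x [i, j])"
proof -
  \<comment> \<open>Distinct pairs of letters give distinct words, so only one term of the double
    sum meets \<open>[k, l]\<close>.\<close>
  have "(\<Sum>k'\<le>N. \<Sum>l'\<le>N. c k' l' when [k', l'] = [k, l]) = (c k l :: complex)" for c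
  proof -
    have "(\<Sum>k'\<le>N. \<Sum>l'\<le>N. c k' l' when [k', l'] = [k, l])
       = (\<Sum>k'\<le>N. if k' = k then (\<Sum>l'\<le>N. if l' = l then c k' l' else 0) else 0)"
      by (intro sum.cong refl) (auto simp: when_def intro!: sum.cong sum.neutral)
    then show ?thesis using assms by simp
  qed
  then show ?thesis
    by (simp add: tensor_op_def lookup_sum lookup_single)
qed

text \<open>The operator sends the word \<open>[b, d]\<close> to \<open>[a, c]\<close> and kills the
  other words, so on coefficients the direction is reversed: the output at \<open>[a, c]\<close> is
  the input at \<open>[b, d]\<close>.\<close>

lemma lookup_tensor_op_munit:
  assumes "k \<le> N" "l \<le> N" "b \<le> N" "d \<le> N"
  shows "Poly_Mapping.lookup (tensor_op N (munit N a b) (munit N c d) x) [k, l]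
    = (if k = a \<and> l = c then Poly_Mapping.lookup x [b, d] else 0)"
proof -
  have [simp]: "munit N a b $$ (k, i) = (if k = a then if i = b then 1 else 0 else 0)"
    "munit N c d $$ (l, i) = (if l = c then if i = d then 1 else 0 else 0)" if "i \<le> N" for i
    using assms that by (auto simp: munit_def)
  have "(\<Sum>i\<le>N. \<Sum>j\<le>N. if i = b then if j = d then Poly_Mapping.lookup x [i, j] else 0 else 0)
     = (\<Sum>i\<le>N. if i = b then \<Sum>j\<le>N. if j = d then Poly_Mapping.lookup x [i, j] else 0 else 0)"
    by (intro sum.cong refl) auto
  then have "(\<Sum>i\<le>N. \<Sum>j\<le>N. if i = b then if j = d then Poly_Mapping.lookup x [i, j] else 0 else 0)
     = Poly_Mapping.lookup x [b, d]"
    using assms by simp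
  moreover have "(\<Sum>i\<le>N. \<Sum>j\<le>N. munit N a b $$ (k, i) * munit N c d $$ (l, j) * Poly_Mapping.lookup x [i, j])
     = (if k = a \<and> l = c then
          \<Sum>i\<le>N. \<Sum>j\<le>N. if i = b then if j = d then Poly_Mapping.lookup x [i, j] else 0 else 0
        else 0)"
    by (auto intro!: sum.cong sum.neutral)
  ultimately show ?thesis
    using assms by (simp add: lookup_tensor_op)
qed

lemma lookup_tensor_op_length:
  "(\<And>k l. k \<le> N \<Longrightarrow> l \<le> N \<Longrightarrow> w \<noteq> [k, l]) \<Longrightarrow> Poly_Mapping.lookup (tensor_op N A B x) w = 0"
  by (force simp: tensor_op_def lookup_sum lookup_single when_def intro!: sum.neutral)

text \<open>Of the three sums in the definition, the first meets \<open>[k, l]\<close> only for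
  equal letters, the second only through the flipped word \<open>[l, k]\<close>, and the third only
  when \<open>l < k\<close>, with \<open>[k, l]\<close> itself as source.\<close>

lemma lookup_R_rho:
  assumes "k \<le> N" "l \<le> N"
  shows "Poly_Mapping.lookup (R_rho N q x) [k, l] =
    (if k = l then q * Poly_Mapping.lookup x [k, k]
     else Poly_Mapping.lookup x [l, k]
       + (if l < k then (q - inverse q) * Poly_Mapping.lookup x [k, l] else 0))"
proof -
  let ?L = Poly_Mapping.lookup
  have 1: "(\<Sum>i\<le>N. ?L (tensor_op N (munit N i i) (munit N i i) x) [k, l])
     = (if k = l then ?L x [k, k] else 0)"
  proof -
    have "(\<Sum>i\<le>N. ?L (tensor_op N (munit N i i) (munit N i i) x) [k, l])
       = (\<Sum>i\<le>N. if k = i then (if k = l then ?L x [k, k] else 0) else 0)"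
      using assms by (intro sum.cong refl) (auto simp: lookup_tensor_op_munit)
    then show ?thesis using assms by simp
  qed
  have fin: "finite {(i, j). i \<le> N \<and> j \<le> N \<and> P i j}" for P
    by (rule finite_subset[of _ "{..N} \<times> {..N}"]) auto
  have 2: "(\<Sum>(i, j) | i \<le> N \<and> j \<le> N \<and> i \<noteq> j. ?L (tensor_op N (munit N i j) (munit N j i) x) [k, l])
     = (if k = l then 0 else ?L x [l, k])"
  proof -
    have "(\<Sum>(i, j) | i \<le> N \<and> j \<le> N \<and> i \<noteq> j. ?L (tensor_op N (munit N i j) (munit N j i) x) [k, l])
       = (\<Sum>p | p \<in> {(i, j). i \<le> N \<and> j \<le> N \<and> i \<noteq> j}. if p = (k, l) then ?L x [l, k] else 0)"
      using assms by (intro sum.cong) (auto simp: lookup_tensor_op_munit split: if_splits)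
    then show ?thesis using assms by (simp add: sum.delta fin)
  qed
  have 3: "(\<Sum>(i, j) | i \<le> N \<and> j \<le> N \<and> i < j. ?L (tensor_op N (munit N j j) (munit N i i) x) [k, l])
     = (if l < k then ?L x [k, l] else 0)"
  proof -
    have "(\<Sum>(i, j) | i \<le> N \<and> j \<le> N \<and> i < j. ?L (tensor_op N (munit N j j) (munit N i i) x) [k, l])
       = (\<Sum>p | p \<in> {(i, j). i \<le> N \<and> j \<le> N \<and> i < j}. if p = (l, k) then ?L x [k, l] else 0)"
      using assms by (intro sum.cong) (auto simp: lookup_tensor_op_munit split: if_splits)
    then show ?thesis using assms by (simp add: sum.delta fin)
  qed
  show ?thesis
    using 1 2 3 by (simp add: R_rho_def lookup_add lookup_sum case_prod_beta)
qed

lemma lookup_R_rho_length: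
  "(\<And>k l. k \<le> N \<Longrightarrow> l \<le> N \<Longrightarrow> w \<noteq> [k, l]) \<Longrightarrow> Poly_Mapping.lookup (R_rho N q x) w = 0"
  by (simp add: R_rho_def lookup_add lookup_sum case_prod_beta lookup_tensor_op_length)

text \<open>The braiding fixes \<open>[k, k]\<close>. On the span of \<open>[k, l]\<close> and
  \<open>[l, k]\<close> with \<open>k < l\<close>, the two coefficient equations differ by the
  factor \<open>- inverse q\<close>, which leaves one condition for each pair.\<close>

lemma braiding_fixed_iff:
  assumes "q \<noteq> 0" and x: "x \<in> tensor_deg N 2"
  shows "x - braiding N q x = 0 \<longleftrightarrow>
    (\<forall>k l. k < l \<and> l \<le> N \<longrightarrow> Poly_Mapping.lookup x [k, l] = inverse q * Poly_Mapping.lookup x [l, k])"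
    (is "?F \<longleftrightarrow> ?S")
proof
  assume F: ?F
  show ?S
  proof (intro allI impI)
    fix k l assume "k < l \<and> l \<le> N"
    moreover have "Poly_Mapping.lookup x [k, l] = Poly_Mapping.lookup (braiding N q x) [k, l]"
      using F by simp
    ultimately show "Poly_Mapping.lookup x [k, l] = inverse q * Poly_Mapping.lookup x [l, k]"
      by (simp add: braiding_def lookup_R_rho)
  qed
next
  assume S: ?S
  have "Poly_Mapping.lookup x w = Poly_Mapping.lookup (braiding N q x) w" for w
  proof (cases "\<exists>k l. k \<le> N \<and> l \<le> N \<and> w = [k, l]")
    case True
    then obtain k l where w: "k \<le> N" "l \<le> N" "w = [k, l]" by blast
    consider "k = l" | "k < l" | "l < k" by linarith
    then show ?thesis
      using S assms(1) w by cases (auto simp: braiding_def lookup_R_rho field_simps)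
  next
    case False
    \<comment> \<open>At words other than two letters of the alphabet both sides vanish:
      \<open>x\<close> by its degree, the braiding by the form of its values.\<close>
    have "w \<notin> Poly_Mapping.keys x"
    proof
      assume "w \<in> Poly_Mapping.keys x"
      with x have "length w = 2" "set w \<subseteq> {..N}" by (auto simp: tensor_deg_def)
      then obtain k l where "w = [k, l]" "k \<le> N" "l \<le> N"
        by (auto simp: length_Suc_conv numeral_2_eq_2)
      then show False using False by blast
    qed
    moreover have "Poly_Mapping.lookup (R_rho N q x) w = 0"
      using False by (intro lookup_R_rho_length) blast
    ultimately show ?thesis by (simp add: braiding_def in_keys_iff)
  qed
  then show ?F by (simp add: poly_mapping_eqI)
qed

section \<open>Straightening modulo the ideal of relations\<close>

lemma tensor_algebra_simps [simp]:
  "add (tensor_algebra N) = (+)" "monoid.mult (tensor_algebra N) = (*)"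
  "zero (tensor_algebra N) = 0" "one (tensor_algebra N) = 1"
  by (simp_all add: tensor_algebra_def)

lemma tensor_carrier_iff:
  "x \<in> carrier (tensor_algebra N) \<longleftrightarrow> (\<forall>w\<in>Poly_Mapping.keys x. set w \<subseteq> {..N})"
  by (simp add: tensor_algebra_def)

lemma tensor_carrier_add:
  "x \<in> carrier (tensor_algebra N) \<Longrightarrow> y \<in> carrier (tensor_algebra N) \<Longrightarrow> x + y \<in> carrier (tensor_algebra N)"
  using Poly_Mapping.keys_add[of x y] by (auto simp: tensor_carrier_iff)

lemma tensor_carrier_pscale:
  "x \<in> carrier (tensor_algebra N) \<Longrightarrow> pscale s x \<in> carrier (tensor_algebra N)"
  by (auto simp: tensor_carrier_iff in_keys_iff)

lemma tensor_carrier_uminus: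
  "x \<in> carrier (tensor_algebra N) \<Longrightarrow> - x \<in> carrier (tensor_algebra N)"
  by (auto simp: tensor_carrier_iff in_keys_iff)

lemma tensor_carrier_minus:
  "x \<in> carrier (tensor_algebra N) \<Longrightarrow> y \<in> carrier (tensor_algebra N) \<Longrightarrow> x - y \<in> carrier (tensor_algebra N)"
  using tensor_carrier_add[of x N "- y"] tensor_carrier_uminus by simp

lemma tensor_carrier_zero: "0 \<in> carrier (tensor_algebra N)"
  by (simp add: tensor_carrier_iff)

lemma tensor_carrier_mult:
  assumes "x \<in> carrier (tensor_algebra N)" "y \<in> carrier (tensor_algebra N)"
  shows "x * y \<in> carrier (tensor_algebra N)"
  using assms Poly_Mapping.keys_mult[of x y]
  by (fastforce simp: tensor_carrier_iff plus_list_def)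

lemma tensor_carrier_single:
  "set w \<subseteq> {..N} \<Longrightarrow> Poly_Mapping.single w s \<in> carrier (tensor_algebra N)"
  by (simp add: tensor_carrier_iff)

lemma tensor_carrier_sum:
  "(\<And>i. i \<in> S \<Longrightarrow> f i \<in> carrier (tensor_algebra N)) \<Longrightarrow> sum f S \<in> carrier (tensor_algebra N)"
  by (induction S rule: infinite_finite_induct) (auto intro: tensor_carrier_zero tensor_carrier_add)

lemma tensor_deg_carrier: "x \<in> tensor_deg N m \<Longrightarrow> x \<in> carrier (tensor_algebra N)"
  by (auto simp: tensor_carrier_iff tensor_deg_def)

lemma tensor_deg_single: "length w = m \<Longrightarrow> set w \<subseteq> {..N} \<Longrightarrow> Poly_Mapping.single w s \<in> tensor_deg N m"
  by (auto simp: tensor_deg_def)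

lemma tensor_deg_add: "x \<in> tensor_deg N m \<Longrightarrow> y \<in> tensor_deg N m \<Longrightarrow> x + y \<in> tensor_deg N m"
  using Poly_Mapping.keys_add[of x y] by (auto simp: tensor_deg_def)

lemma tensor_deg_pscale: "x \<in> tensor_deg N m \<Longrightarrow> pscale s x \<in> tensor_deg N m"
  by (auto simp: tensor_deg_def in_keys_iff)

lemma tensor_deg_zero: "0 \<in> tensor_deg N m"
  by (simp add: tensor_deg_def)

lemma tensor_deg_sum:
  "(\<And>i. i \<in> S \<Longrightarrow> f i \<in> tensor_deg N m) \<Longrightarrow> sum f S \<in> tensor_deg N m"
  by (induction S rule: infinite_finite_induct) (auto intro: tensor_deg_zero tensor_deg_add)

lemma ring_tensor_algebra: "ring (tensor_algebra N)"
proof (rule ringI)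
  show "abelian_group (tensor_algebra N)"
  proof (rule abelian_groupI)
    fix x assume "x \<in> carrier (tensor_algebra N)"
    then show "\<exists>y\<in>carrier (tensor_algebra N). y \<oplus>\<^bsub>tensor_algebra N\<^esub> x = \<zero>\<^bsub>tensor_algebra N\<^esub>"
      by (intro bexI[of _ "- x"]) (auto intro: tensor_carrier_uminus)
  qed (auto simp: add_ac intro: tensor_carrier_zero tensor_carrier_add)
  show "monoid (tensor_algebra N)"
    by (rule monoidI)
      (auto simp: mult.assoc intro: tensor_carrier_mult, simp add: tensor_carrier_iff zero_list_def)
qed (auto simp: algebra_simps)

lemma ideal_tensor_algebraI:
  assumes "J \<subseteq> carrier (tensor_algebra N)" "0 \<in> J"
    and "\<And>x y. x \<in> J \<Longrightarrow> y \<in> J \<Longrightarrow> x + y \<in> J"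
    and "\<And>x. x \<in> J \<Longrightarrow> - x \<in> J"
    and "\<And>a x. x \<in> J \<Longrightarrow> a \<in> carrier (tensor_algebra N) \<Longrightarrow> a * x \<in> J"
    and "\<And>a x. x \<in> J \<Longrightarrow> a \<in> carrier (tensor_algebra N) \<Longrightarrow> x * a \<in> J"
  shows "ideal J (tensor_algebra N)"
proof (rule idealI)
  interpret ring "tensor_algebra N" by (rule ring_tensor_algebra)
  \<comment> \<open>Additive inverses are unique, so the abstract inverse of the additive group is
    ordinary negation and the closure under \<open>- x\<close> applies.\<close>
  have inv: "inv\<^bsub>add_monoid (tensor_algebra N)\<^esub> x = - x" if "x \<in> carrier (tensor_algebra N)" for x
    using minus_equality[of "- x" x] that tensor_carrier_uminus by (simp add: a_inv_def)
  show "subgroup J (add_monoid (tensor_algebra N))"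
  proof (rule group.subgroupI)
    show "group (add_monoid (tensor_algebra N))" by (rule a_group)
    show "inv\<^bsub>add_monoid (tensor_algebra N)\<^esub> x \<in> J" if "x \<in> J" for x
      using that assms(1,4) inv by auto
  qed (use assms in auto)
qed (use assms ring_tensor_algebra in auto)

section \<open>The ideal of relations\<close>

definition ext_relations :: "nat \<Rightarrow> complex \<Rightarrow> tensor set" where
  "ext_relations N q = {x \<in> tensor_deg N 2. x - braiding N q x = 0}"

lemma ideal_ext_ideal: "ideal (ext_ideal N q) (tensor_algebra N)"
  unfolding ext_ideal_def
  by (rule ring.genideal_ideal[OF ring_tensor_algebra]) (auto intro: tensor_deg_carrier)

lemma ext_relations_subset: "ext_relations N q \<subseteq> ext_ideal N q"
  unfolding ext_ideal_def ext_relations_def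
  by (rule ring.genideal_self[OF ring_tensor_algebra]) (auto intro: tensor_deg_carrier)

lemma ext_ideal_zero: "0 \<in> ext_ideal N q"
  using additive_subgroup.zero_closed[OF ideal.axioms(1)[OF ideal_ext_ideal]] by simp

lemma ext_ideal_add: "x \<in> ext_ideal N q \<Longrightarrow> y \<in> ext_ideal N q \<Longrightarrow> x + y \<in> ext_ideal N q"
  using additive_subgroup.a_closed[OF ideal.axioms(1)[OF ideal_ext_ideal]] by simp

lemma ext_ideal_mult_left:
  "x \<in> ext_ideal N q \<Longrightarrow> a \<in> carrier (tensor_algebra N) \<Longrightarrow> a * x \<in> ext_ideal N q"
  using ideal.I_l_closed[OF ideal_ext_ideal] by simp

lemma ext_ideal_mult_right:
  "x \<in> ext_ideal N q \<Longrightarrow> a \<in> carrier (tensor_algebra N) \<Longrightarrow> x * a \<in> ext_ideal N q"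
  using ideal.I_r_closed[OF ideal_ext_ideal] by simp

lemma ext_ideal_pscale: "x \<in> ext_ideal N q \<Longrightarrow> pscale s x \<in> ext_ideal N q"
  by (simp add: pscale_conv_mult ext_ideal_mult_left tensor_carrier_single)

lemma ext_ideal_uminus: "x \<in> ext_ideal N q \<Longrightarrow> - x \<in> ext_ideal N q"
  using ext_ideal_pscale[of x N q "- 1"] by simp

lemma ext_ideal_diff: "x \<in> ext_ideal N q \<Longrightarrow> y \<in> ext_ideal N q \<Longrightarrow> x - y \<in> ext_ideal N q"
  using ext_ideal_add[of x N q "- y"] ext_ideal_uminus by simp

lemma ext_ideal_sum:
  "(\<And>i. i \<in> S \<Longrightarrow> f i \<in> ext_ideal N q) \<Longrightarrow> sum f S \<in> ext_ideal N q"
  by (induction S rule: infinite_finite_induct) (auto intro: ext_ideal_zero ext_ideal_add)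

section \<open>Straightening vanishes on the ideal\<close>

lemma straighten_add: "straighten q (x + y) = straighten q x + straighten q y"
  by (simp add: straighten_def linext.add)

lemma straighten_diff: "straighten q (x - y) = straighten q x - straighten q y"
  by (simp add: straighten_def linext.diff)

lemma straighten_uminus: "straighten q (- x) = - straighten q x"
  by (simp add: straighten_def linext.neg)

lemma straighten_pscale: "straighten q (pscale s x) = pscale s (straighten q x)"
  by (simp add: straighten_def linext.scale)

lemma straighten_sum: "straighten q (sum f S) = (\<Sum>i\<in>S. straighten q (f i))"
  by (simp add: straighten_def linext.sum)

lemma straighten_zero [simp]: "straighten q 0 = 0"
  by (simp add: straighten_def linext.zero)

lemma straighten_single:
  "straighten q (Poly_Mapping.single w s) = Poly_Mapping.single (sort w) (s * word_sign q w)"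
  by (simp add: straighten_def)

lemma poly_mapping_eq_uminus:
  fixes x :: "'b \<Rightarrow>\<^sub>0 complex"
  assumes "x = - x"
  shows "x = 0"
proof (rule poly_mapping_eqI)
  fix w
  from assms have "Poly_Mapping.lookup x w = Poly_Mapping.lookup (- x) w" by (rule arg_cong)
  then show "Poly_Mapping.lookup x w = Poly_Mapping.lookup 0 w" by (simp add: equal_neg_zero)
qed

text \<open>Exchanging the two indices turns the sum into its own negative, and the coefficients
  have characteristic 0. The case \<open>k = l\<close> of the assumption takes care of the
  diagonal.\<close>

lemma sum_antisymmetric_zero:
  fixes G :: "'i \<Rightarrow> 'i \<Rightarrow> 'b \<Rightarrow>\<^sub>0 complex"
  assumes "\<And>k l. k \<in> S \<Longrightarrow> l \<in> S \<Longrightarrow> G l k = - G k l"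
  shows "(\<Sum>k\<in>S. \<Sum>l\<in>S. G k l) = 0"
proof -
  have "(\<Sum>k\<in>S. \<Sum>l\<in>S. G k l) = (\<Sum>k\<in>S. \<Sum>l\<in>S. G l k)" by (rule sum.swap)
  also have "\<dots> = (\<Sum>k\<in>S. \<Sum>l\<in>S. - G k l)"
    by (intro sum.cong refl assms)
  finally have "(\<Sum>k\<in>S. \<Sum>l\<in>S. G k l) = - (\<Sum>k\<in>S. \<Sum>l\<in>S. G k l)"
    by (simp add: sum_negf)
  then show ?thesis by (rule poly_mapping_eq_uminus)
qed

lemma tensor_deg_2_expand:
  assumes "x \<in> tensor_deg N 2"
  shows "x = (\<Sum>k\<le>N. \<Sum>l\<le>N. Poly_Mapping.single [k, l] (Poly_Mapping.lookup x [k, l]))"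
proof -
  let ?K = "(\<lambda>(k, l). [k, l]) ` ({..N} \<times> {..N})"
  have "Poly_Mapping.keys x \<subseteq> ?K"
  proof
    fix w assume "w \<in> Poly_Mapping.keys x"
    with assms have "length w = 2" "set w \<subseteq> {..N}" by (auto simp: tensor_deg_def)
    then show "w \<in> ?K" by (auto simp: length_Suc_conv numeral_2_eq_2)
  qed
  then have "x = (\<Sum>w\<in>?K. Poly_Mapping.single w (Poly_Mapping.lookup x w))"
    using linext_superset[of ?K x "\<lambda>w. Poly_Mapping.single w 1"] by (simp add: linext_id)
  also have "\<dots> = (\<Sum>(k, l)\<in>{..N} \<times> {..N}. Poly_Mapping.single [k, l] (Poly_Mapping.lookup x [k, l]))"
    by (subst sum.reindex) (auto simp: inj_on_def case_prod_beta)
  finally show ?thesis by (simp add: sum.cartesian_product)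
qed

text \<open>The terms of \<open>[k, l]\<close> and \<open>[l, k]\<close> straighten to the same
  word. For \<open>k < l\<close> the relation gives the first a factor \<open>inverse q\<close>, and
  the additional inversion gives the second a factor \<open>- inverse q\<close>, so they cancel;
  squares have sign 0.\<close>

lemma straighten_relation_word:
  assumes "q \<noteq> 0" "x \<in> ext_relations N q"
  shows "straighten q (Poly_Mapping.single a 1 * x * Poly_Mapping.single b 1) = 0"
proof -
  let ?L = "Poly_Mapping.lookup x"
  have x: "x \<in> tensor_deg N 2" and L: "k < l \<Longrightarrow> l \<le> N \<Longrightarrow> ?L [k, l] = inverse q * ?L [l, k]" for k l
    using assms braiding_fixed_iff[of q x N] by (auto simp: ext_relations_def)
  define G where "G k l = Poly_Mapping.single (sort (a @ [k, l] @ b)) (?L [k, l] * word_sign q (a @ [k, l] @ b))" for k l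
  have swap: "G l k = - G k l" if "k < l" "l \<le> N" for k l
    using that L[of k l] word_sign_swap[of k l q a b] sort_swap[of a l k b] assms(1)
    by (simp add: G_def single_uminus[symmetric] ac_simps del: append.append_Cons append_Cons)
  have "straighten q (Poly_Mapping.single a 1 * x * Poly_Mapping.single b 1) = (\<Sum>k\<le>N. \<Sum>l\<le>N. G k l)"
    by (rule trans[OF arg_cong[OF tensor_deg_2_expand[OF x]]])
      (simp add: sum_distrib_left sum_distrib_right single_word_mult straighten_sum straighten_single G_def)
  also have "\<dots> = 0"
  proof (rule sum_antisymmetric_zero)
    fix k l assume "k \<in> {..N}" "l \<in> {..N}"
    moreover have "G k k = 0" by (simp add: G_def word_sign_def)
    ultimately show "G l k = - G k l"
      using swap[of k l] swap[of l k] by (cases k l rule: linorder_cases) auto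
  qed
  finally show ?thesis .
qed

lemma straighten_relation:
  assumes "q \<noteq> 0" "x \<in> ext_relations N q"
  shows "straighten q (u * x * v) = 0"
proof -
  let ?e = "linext (\<lambda>k. Poly_Mapping.single k 1)"
  have "straighten q (?e u * x * ?e v) = 0"
    unfolding linext_def
    by (simp only: sum_distrib_left sum_distrib_right straighten_sum pscale_mult_left
        pscale_mult_right straighten_pscale straighten_relation_word[OF assms] pscale.scale_zero_right
        sum.neutral_const)
  then show ?thesis by (simp add: linext_id)
qed

lemma straighten_ext_ideal:
  assumes "q \<noteq> 0" "x \<in> ext_ideal N q"
  shows "straighten q x = 0"
proof -
  \<comment> \<open>The kernel of \<open>straighten\<close> is not visibly an ideal, since
    \<open>straighten\<close> is not multiplicative. Asking that all products
    \<open>u * x * v\<close> be killed builds in closure under multiplication on both sides; the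
    choice \<open>u = v = 1\<close> then recovers the kernel.\<close>
  let ?J = "{x \<in> carrier (tensor_algebra N). \<forall>u v. straighten q (u * x * v) = 0}"
  have "ideal ?J (tensor_algebra N)"
  proof (rule ideal_tensor_algebraI)
    fix a x assume x: "x \<in> ?J" "a \<in> carrier (tensor_algebra N)"
    then have "straighten q ((u * a) * x * v) = 0" "straighten q (u * x * (a * v)) = 0" for u v
      by blast+
    then have "straighten q (u * (a * x) * v) = 0" "straighten q (u * (x * a) * v) = 0" for u v
      by (simp_all only: mult.assoc)
    with x show "a * x \<in> ?J" "x * a \<in> ?J" by (auto intro: tensor_carrier_mult)
  qed (auto simp: distrib_left distrib_right straighten_add straighten_uminus
      intro: tensor_carrier_zero tensor_carrier_add tensor_carrier_uminus)
  moreover have "ext_relations N q \<subseteq> ?J"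
    using straighten_relation[OF assms(1)] by (auto simp: ext_relations_def intro: tensor_deg_carrier)
  ultimately have "ext_ideal N q \<subseteq> ?J"
    unfolding ext_ideal_def ext_relations_def
    by (rule ring.genideal_minimal[OF ring_tensor_algebra])
  with assms(2) have "straighten q (1 * x * 1) = 0" by blast
  then show ?thesis by simp
qed

section \<open>Straightening is the identity modulo the ideal\<close>

lemma ext_relation_square:
  assumes "q \<noteq> 0" "k \<le> N"
  shows "Poly_Mapping.single [k, k] 1 \<in> ext_relations N q"
  using assms tensor_deg_single[of "[k, k]" 2 N 1]
  by (auto simp: ext_relations_def braiding_fixed_iff lookup_single when_def
      simp del: right_minus_eq)

text \<open>The rewriting rule for a descent: in the quotient, \<open>[l, k]\<close> becomes
  \<open>- inverse q\<close> times \<open>[k, l]\<close>.\<close>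

lemma ext_relation_swap:
  assumes "q \<noteq> 0" "k < l" "l \<le> N"
  shows "Poly_Mapping.single [l, k] 1 + Poly_Mapping.single [k, l] (inverse q) \<in> ext_relations N q"
proof -
  have "Poly_Mapping.single [l, k] 1 + Poly_Mapping.single [k, l] (inverse q) \<in> tensor_deg N 2"
    using assms by (intro tensor_deg_add tensor_deg_single) auto
  then show ?thesis
    using assms by (auto simp: ext_relations_def braiding_fixed_iff lookup_add lookup_single when_def
        simp del: right_minus_eq)
qed

text \<open>Induction on inversions. A strictly increasing word is its own straightening; a word
  with two equal neighbours lies in the ideal and straightens to 0; at a descent the relation passes
  to a word with one inversion less.\<close>

lemma straighten_word_cong:
  assumes "q \<noteq> 0" "set w \<subseteq> {..N}"
  shows "Poly_Mapping.single w 1 - straighten q (Poly_Mapping.single w 1) \<in> ext_ideal N q"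
  using assms(2)
proof (induction "word_inversions w" arbitrary: w rule: less_induct)
  case less
  show ?case
  proof (cases "sorted_wrt (<) w")
    case True
    then have "sort w = w" "word_sign q w = 1"
      by (auto simp: strict_sorted_iff sorted_sort_id word_sign_def word_inversions_sorted)
    then show ?thesis by (simp add: straighten_single ext_ideal_zero)
  next
    case False
    then obtain u k l v where w: "w = u @ [k, l] @ v" "\<not> k < l"
      using adjacent_descent by blast
    \<comment> \<open>The ideal is two-sided, so a relation may be applied in the middle of a
      word.\<close>
    have sandwich: "Poly_Mapping.single u 1 * r * Poly_Mapping.single v 1 \<in> ext_ideal N q"
      if "r \<in> ext_relations N q" for r
      using that ext_relations_subset less.prems w
      by (intro ext_ideal_mult_left ext_ideal_mult_right tensor_carrier_single) auto
    show ?thesis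
    proof (cases "k = l")
      case True
      then have "word_sign q w = 0" using w by (simp add: word_sign_def)
      moreover have "Poly_Mapping.single w 1 \<in> ext_ideal N q"
        using sandwich[OF ext_relation_square[of q k]] True less.prems w assms(1)
        by (simp add: single_word_mult)
      ultimately show ?thesis by (simp add: straighten_single)
    next
      case False
      with w have lk: "l < k" by simp
      let ?w = "u @ [l, k] @ v"
      have 1: "Poly_Mapping.single w 1 + Poly_Mapping.single ?w (inverse q) \<in> ext_ideal N q"
        using sandwich[OF ext_relation_swap[of q l k]] lk less.prems w assms(1)
        by (simp add: single_word_mult distrib_left distrib_right)
      have "Poly_Mapping.single ?w 1 - straighten q (Poly_Mapping.single ?w 1) \<in> ext_ideal N q"
        using less.prems w word_inversions_swap[OF lk, of u v] by (intro less.hyps) auto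
      then have 2: "pscale (inverse q) (Poly_Mapping.single ?w 1 - straighten q (Poly_Mapping.single ?w 1)) \<in> ext_ideal N q"
        by (rule ext_ideal_pscale)
      have 3: "straighten q (Poly_Mapping.single w 1) = - pscale (inverse q) (straighten q (Poly_Mapping.single ?w 1))"
        using w word_sign_swap[OF lk, of q u v] sort_swap[of u k l v]
        by (simp add: straighten_single single_uminus)
      show ?thesis
        \<comment> \<open>In the difference the swapped word cancels; what remains is
          \<open>w\<close> plus \<open>inverse q\<close> times the straightening of the swapped
          word, and by \<open>3\<close> this is \<open>w\<close> minus its own
          straightening.\<close>
        using ext_ideal_diff[OF 1 2] by (simp add: 3 pscale.scale_right_diff_distrib)
    qed
  qed
qed

lemma straighten_cong:
  assumes "q \<noteq> 0" "x \<in> carrier (tensor_algebra N)"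
  shows "x - straighten q x \<in> ext_ideal N q"
proof -
  let ?e = "linext (\<lambda>k. Poly_Mapping.single k 1) x"
  have "?e - straighten q ?e
    = (\<Sum>w\<in>Poly_Mapping.keys x. pscale (Poly_Mapping.lookup x w)
        (Poly_Mapping.single w 1 - straighten q (Poly_Mapping.single w 1)))"
    by (simp only: linext_def straighten_sum straighten_pscale sum_subtractf pscale.scale_right_diff_distrib)
  also have "\<dots> \<in> ext_ideal N q"
    using assms by (intro ext_ideal_sum ext_ideal_pscale straighten_word_cong) (auto simp: tensor_carrier_iff)
  finally show ?thesis by (simp only: linext_id)
qed

section \<open>Equality of classes and normal forms\<close>

lemma mem_ext_class: "y \<in> ext_class N q x \<longleftrightarrow> y - x \<in> ext_ideal N q"
  by (auto simp: ext_class_def a_r_coset_def' intro: bexI[of _ "y - x"])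

lemma ext_class_eq_iff: "ext_class N q x = ext_class N q y \<longleftrightarrow> x - y \<in> ext_ideal N q"
proof
  assume "ext_class N q x = ext_class N q y"
  moreover have "x \<in> ext_class N q x" by (simp add: mem_ext_class ext_ideal_zero)
  ultimately show "x - y \<in> ext_ideal N q" by (simp add: mem_ext_class)
next
  assume *: "x - y \<in> ext_ideal N q"
  have "z - x \<in> ext_ideal N q \<longleftrightarrow> z - y \<in> ext_ideal N q" for z
    using ext_ideal_add[OF _ *, of "z - x"] ext_ideal_diff[OF _ *, of "z - y"] by auto
  then show "ext_class N q x = ext_class N q y" by (auto simp: mem_ext_class)
qed

text \<open>On the tensor algebra the kernel of \<open>straighten\<close> is exactly the ideal: one
  inclusion is \<open>straighten_ext_ideal\<close>, the other follows from
  \<open>straighten_cong\<close>. This is the test for equality used from here on.\<close>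

lemma ext_class_eq_straighten:
  assumes "q \<noteq> 0" "x \<in> carrier (tensor_algebra N)" "y \<in> carrier (tensor_algebra N)"
  shows "ext_class N q x = ext_class N q y \<longleftrightarrow> straighten q x = straighten q y"
proof -
  have "straighten q (x - y) = 0 \<Longrightarrow> x - y \<in> ext_ideal N q"
    using straighten_cong[OF assms(1) tensor_carrier_minus[OF assms(2,3)]] by simp
  then show ?thesis
    using straighten_ext_ideal[OF assms(1), of "x - y"] by (auto simp: ext_class_eq_iff straighten_diff)
qed

text \<open>Words with a repeated letter have sign 0, and sorting any other word makes it strictly
  increasing.\<close>

lemma keys_straighten:
  assumes "x \<in> tensor_deg N m"
  shows "Poly_Mapping.keys (straighten q x) \<subseteq> basis_words N m"
proof
  fix z assume "z \<in> Poly_Mapping.keys (straighten q x)"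
  then have "(\<Sum>w\<in>Poly_Mapping.keys x. (Poly_Mapping.lookup x w * word_sign q w when sort w = z)) \<noteq> 0"
    by (simp add: straighten_def linext_def lookup_sum lookup_single in_keys_iff)
  then obtain w where w: "w \<in> Poly_Mapping.keys x" "word_sign q w \<noteq> 0" "sort w = z"
    by (auto elim!: sum.not_neutral_contains_not_neutral simp: when_def split: if_splits)
  then have "distinct w" by (auto simp: word_sign_def split: if_splits)
  with w assms show "z \<in> basis_words N m"
    by (fastforce simp: basis_words_def tensor_deg_def strict_sorted_iff)
qed

lemma straighten_normal:
  assumes "Poly_Mapping.keys x \<subseteq> basis_words N m"
  shows "straighten q x = x"
proof -
  have "straighten q x = linext (\<lambda>w. Poly_Mapping.single w 1) x"
    unfolding straighten_def linext_def
  proof (rule sum.cong)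
    fix w assume "w \<in> Poly_Mapping.keys x"
    with assms have "sorted_wrt (<) w" by (auto simp: basis_words_def)
    then have "sort w = w" "word_sign q w = 1"
      by (auto simp: strict_sorted_iff sorted_sort_id word_sign_def word_inversions_sorted)
    then show "pscale (Poly_Mapping.lookup x w) (Poly_Mapping.single (sort w) (word_sign q w))
      = pscale (Poly_Mapping.lookup x w) (Poly_Mapping.single w 1)" by simp
  qed simp
  then show ?thesis by (simp only: linext_id)
qed

text \<open>Existence is \<open>straighten_cong\<close> in disguise. Uniqueness, that is, the linear
  independence of the increasing words in the quotient, holds because \<open>straighten\<close>
  fixes their combinations.\<close>

lemma normal_form_ext_class:
  assumes "q \<noteq> 0" "x \<in> tensor_deg N m"
  shows "normal_form N q m (ext_class N q x) = straighten q x"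
  unfolding normal_form_def
proof (rule the_equality)
  have carrier: "y \<in> carrier (tensor_algebra N)" if "Poly_Mapping.keys y \<subseteq> basis_words N m" for y
    using that by (auto simp: tensor_carrier_iff basis_words_def)
  note keys = keys_straighten[OF assms(2), of q]
  have "straighten q (straighten q x) = straighten q x" by (rule straighten_normal[OF keys])
  then show "Poly_Mapping.keys (straighten q x) \<subseteq> basis_words N m
      \<and> ext_class N q (straighten q x) = ext_class N q x"
    using assms keys carrier by (simp add: ext_class_eq_straighten tensor_deg_carrier)
  fix y assume "Poly_Mapping.keys y \<subseteq> basis_words N m \<and> ext_class N q y = ext_class N q x"
  then show "y = straighten q x"
    using assms carrier[of y] straighten_normal[of y N m q]
    by (simp add: ext_class_eq_straighten tensor_deg_carrier)
qed

section \<open>Operations in the quantum exterior algebra\<close>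

lemma ext_class_mult:
  assumes "x \<in> carrier (tensor_algebra N)" "y \<in> carrier (tensor_algebra N)"
  shows "ext_class N q x \<otimes>\<^bsub>ext_algebra N q\<^esub> ext_class N q y = ext_class N q (x * y)"
  using ideal.rcoset_mult_add[OF ideal_ext_ideal assms, of q]
  by (simp add: ext_class_def ext_algebra_def FactRing_def)

lemma ext_class_add:
  assumes "x \<in> carrier (tensor_algebra N)" "y \<in> carrier (tensor_algebra N)"
  shows "ext_class N q x \<oplus>\<^bsub>ext_algebra N q\<^esub> ext_class N q y = ext_class N q (x + y)"
proof -
  interpret ideal "ext_ideal N q" "tensor_algebra N" by (rule ideal_ext_ideal)
  show ?thesis using a_rcos_sum assms by (simp add: ext_class_def ext_algebra_def FactRing_def)
qed

lemma ext_class_smult: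
  "x \<in> carrier (tensor_algebra N) \<Longrightarrow> ext_smult N q s (ext_class N q x) = ext_class N q (pscale s x)"
  by (simp add: ext_smult_def ext_class_mult tensor_carrier_single pscale_conv_mult)

lemma ext_class_zero: "\<zero>\<^bsub>ext_algebra N q\<^esub> = ext_class N q 0"
  by (auto simp: ext_algebra_def FactRing_def mem_ext_class)

lemma ext_class_carrier:
  "x \<in> carrier (tensor_algebra N) \<Longrightarrow> ext_class N q x \<in> carrier (ext_algebra N q)"
  by (auto simp: ext_algebra_def FactRing_def A_RCOSETS_def' ext_class_def)

lemma ext_class_finsum:
  assumes "finite S" "\<And>k. k \<in> S \<Longrightarrow> h k \<in> carrier (tensor_algebra N)"
  shows "finsum (ext_algebra N q) (\<lambda>k. ext_class N q (h k)) S = ext_class N q (sum h S)"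
proof -
  interpret ring "ext_algebra N q"
    unfolding ext_algebra_def by (rule ideal.quotient_is_ring[OF ideal_ext_ideal])
  show ?thesis
    using assms
  proof (induction S rule: finite_induct)
    case empty
    then show ?case by (simp add: ext_class_zero)
  next
    case (insert k S)
    then have "finsum (ext_algebra N q) (\<lambda>k. ext_class N q (h k)) (insert k S)
      = ext_class N q (h k) \<oplus>\<^bsub>ext_algebra N q\<^esub> ext_class N q (sum h S)"
      by (subst finsum_insert) (auto intro: ext_class_carrier)
    with insert show ?case by (simp add: ext_class_add tensor_carrier_sum)
  qed
qed

lemma ext_deg_add:
  assumes "X \<in> ext_deg N q m" "Y \<in> ext_deg N q m"
  shows "X \<oplus>\<^bsub>ext_algebra N q\<^esub> Y \<in> ext_deg N q m"
  using assms
  by (auto simp: ext_deg_def ext_class_add tensor_deg_carrier intro: imageI tensor_deg_add)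

lemma ext_deg_smult: "X \<in> ext_deg N q m \<Longrightarrow> ext_smult N q s X \<in> ext_deg N q m"
  by (auto simp: ext_deg_def ext_class_smult tensor_deg_carrier intro: imageI tensor_deg_pscale)

lemma ext_word_deg: "length w = m \<Longrightarrow> set w \<subseteq> {..N} \<Longrightarrow> ext_word N q w \<in> ext_deg N q m"
  by (auto simp: ext_deg_def ext_word_def intro!: imageI tensor_deg_single)

text \<open>Evaluating on chosen representatives makes the wedge product a total linear map on formal sums,
  defined also outside the homogeneous components.\<close>

definition ext_rep :: "nat \<Rightarrow> complex \<Rightarrow> tensor set \<Rightarrow> tensor" where
  "ext_rep N q X = (SOME x. x \<in> carrier (tensor_algebra N) \<and> ext_class N q x = X)"

lemma ext_rep:
  assumes "X \<in> ext_deg N q m"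
  shows "ext_rep N q X \<in> carrier (tensor_algebra N)" "ext_class N q (ext_rep N q X) = X"
proof -
  have "\<exists>x. x \<in> carrier (tensor_algebra N) \<and> ext_class N q x = X"
    using assms by (auto simp: ext_deg_def intro: tensor_deg_carrier)
  from someI_ex[OF this]
  show "ext_rep N q X \<in> carrier (tensor_algebra N)" "ext_class N q (ext_rep N q X) = X"
    unfolding ext_rep_def by blast+
qed

section \<open>Maps out of the tensor product\<close>

text \<open>The value depends on the chosen representatives; only its class in the quotient carries
  meaning.\<close>

definition wedge_lift :: "nat \<Rightarrow> complex \<Rightarrow> formal \<Rightarrow> tensor" where
  "wedge_lift N q = linext (\<lambda>(X, Y). ext_rep N q X * ext_rep N q Y)"

text \<open>Moves the sum from the quotient ring, where \<open>wedge_map\<close> is defined, to the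
  tensor algebra, where the linearity of \<open>linext\<close> is available.\<close>

lemma wedge_lift_finsum:
  assumes "Poly_Mapping.keys \<phi> \<subseteq> ext_deg N q i \<times> ext_deg N q j"
  shows "finsum (ext_algebra N q)
      (\<lambda>(X, Y). ext_smult N q (Poly_Mapping.lookup \<phi> (X, Y)) (X \<otimes>\<^bsub>ext_algebra N q\<^esub> Y))
      (Poly_Mapping.keys \<phi>) = ext_class N q (wedge_lift N q \<phi>)"
proof -
  interpret ring "ext_algebra N q"
    unfolding ext_algebra_def by (rule ideal.quotient_is_ring[OF ideal_ext_ideal])
  let ?h = "\<lambda>(X, Y). pscale (Poly_Mapping.lookup \<phi> (X, Y)) (ext_rep N q X * ext_rep N q Y)"
  have h: "?h p \<in> carrier (tensor_algebra N)" if "p \<in> Poly_Mapping.keys \<phi>" for p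
    using that assms by (auto intro!: tensor_carrier_pscale tensor_carrier_mult intro: ext_rep)
  have "(case p of (X, Y) \<Rightarrow> ext_smult N q (Poly_Mapping.lookup \<phi> (X, Y)) (X \<otimes>\<^bsub>ext_algebra N q\<^esub> Y))
      = ext_class N q (?h p)" if "p \<in> Poly_Mapping.keys \<phi>" for p
  proof -
    have "p \<in> ext_deg N q i \<times> ext_deg N q j"
      using assms that by (rule subsetD)
    then obtain X Y where p: "p = (X, Y)" "X \<in> ext_deg N q i" "Y \<in> ext_deg N q j"
      by (rule SigmaE)
    note rep = ext_rep[OF p(2)] ext_rep[OF p(3)]
    have "X \<otimes>\<^bsub>ext_algebra N q\<^esub> Y = ext_class N q (ext_rep N q X * ext_rep N q Y)"
      using ext_class_mult[OF rep(1,3), of q] rep by simp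
    then show ?thesis using p rep by (simp add: ext_class_smult tensor_carrier_mult)
  qed
  then have "finsum (ext_algebra N q)
      (\<lambda>(X, Y). ext_smult N q (Poly_Mapping.lookup \<phi> (X, Y)) (X \<otimes>\<^bsub>ext_algebra N q\<^esub> Y))
      (Poly_Mapping.keys \<phi>) = finsum (ext_algebra N q) (\<lambda>p. ext_class N q (?h p)) (Poly_Mapping.keys \<phi>)"
    using h by (intro finsum_cong') (auto intro: ext_class_carrier)
  also have "\<dots> = ext_class N q (sum ?h (Poly_Mapping.keys \<phi>))"
    using h by (intro ext_class_finsum) auto
  also have "sum ?h (Poly_Mapping.keys \<phi>) = wedge_lift N q \<phi>"
    by (simp add: wedge_lift_def linext_def case_prod_beta)
  finally show ?thesis .
qed

lemma bilinear_relations_cases: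
  assumes "r \<in> bilinear_relations N q i j"
  obtains
    (1) X X' Y where "X \<in> ext_deg N q i" "X' \<in> ext_deg N q i" "Y \<in> ext_deg N q j"
      "r = Poly_Mapping.single (X \<oplus>\<^bsub>ext_algebra N q\<^esub> X', Y) 1
        - Poly_Mapping.single (X, Y) 1 - Poly_Mapping.single (X', Y) 1"
  | (2) X Y Y' where "X \<in> ext_deg N q i" "Y \<in> ext_deg N q j" "Y' \<in> ext_deg N q j"
      "r = Poly_Mapping.single (X, Y \<oplus>\<^bsub>ext_algebra N q\<^esub> Y') 1
        - Poly_Mapping.single (X, Y) 1 - Poly_Mapping.single (X, Y') 1"
  | (3) s X Y where "X \<in> ext_deg N q i" "Y \<in> ext_deg N q j"
      "r = Poly_Mapping.single (ext_smult N q s X, Y) 1 - Poly_Mapping.single (X, Y) s"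
  | (4) s X Y where "X \<in> ext_deg N q i" "Y \<in> ext_deg N q j"
      "r = Poly_Mapping.single (X, ext_smult N q s Y) 1 - Poly_Mapping.single (X, Y) s"
  using assms unfolding bilinear_relations_def by blast

lemma bilinear_relations_add_left:
  "X \<in> ext_deg N q i \<Longrightarrow> X' \<in> ext_deg N q i \<Longrightarrow> Y \<in> ext_deg N q j \<Longrightarrow>
    Poly_Mapping.single (X \<oplus>\<^bsub>ext_algebra N q\<^esub> X', Y) 1 - Poly_Mapping.single (X, Y) 1
      - Poly_Mapping.single (X', Y) 1 \<in> bilinear_relations N q i j"
  unfolding bilinear_relations_def by blast

lemma bilinear_relations_add_right:
  "X \<in> ext_deg N q i \<Longrightarrow> Y \<in> ext_deg N q j \<Longrightarrow> Y' \<in> ext_deg N q j \<Longrightarrow>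
    Poly_Mapping.single (X, Y \<oplus>\<^bsub>ext_algebra N q\<^esub> Y') 1 - Poly_Mapping.single (X, Y) 1
      - Poly_Mapping.single (X, Y') 1 \<in> bilinear_relations N q i j"
  unfolding bilinear_relations_def by blast

lemma bilinear_relations_smult_left:
  "X \<in> ext_deg N q i \<Longrightarrow> Y \<in> ext_deg N q j \<Longrightarrow>
    Poly_Mapping.single (ext_smult N q s X, Y) 1 - Poly_Mapping.single (X, Y) s
      \<in> bilinear_relations N q i j"
  unfolding bilinear_relations_def by blast

lemma bilinear_relations_smult_right:
  "X \<in> ext_deg N q i \<Longrightarrow> Y \<in> ext_deg N q j \<Longrightarrow>
    Poly_Mapping.single (X, ext_smult N q s Y) 1 - Poly_Mapping.single (X, Y) s
      \<in> bilinear_relations N q i j"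
  unfolding bilinear_relations_def by blast

text \<open>Chosen representatives respect sums and scalars only up to the ideal. In each relation
  this defect is multiplied by one further representative, so the result stays in the ideal.\<close>

lemma wedge_lift_relation:
  assumes "r \<in> bilinear_relations N q i j"
  shows "wedge_lift N q r \<in> ext_ideal N q"
proof -
  let ?r = "ext_rep N q"
  have add: "?r (X \<oplus>\<^bsub>ext_algebra N q\<^esub> X') - ?r X - ?r X' \<in> ext_ideal N q"
    if "X \<in> ext_deg N q m" "X' \<in> ext_deg N q m" for X X' m
  proof -
    have "ext_class N q (?r (X \<oplus>\<^bsub>ext_algebra N q\<^esub> X')) = ext_class N q (?r X + ?r X')"
      using ext_rep[OF that(1)] ext_rep[OF that(2)] ext_rep[OF ext_deg_add[OF that]]
      by (simp add: ext_class_add[symmetric])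
    then show ?thesis by (simp add: ext_class_eq_iff diff_diff_eq)
  qed
  have scale: "?r (ext_smult N q s X) - pscale s (?r X) \<in> ext_ideal N q"
    if "X \<in> ext_deg N q m" for X s m
  proof -
    have "ext_class N q (?r (ext_smult N q s X)) = ext_class N q (pscale s (?r X))"
      using ext_rep[OF that] ext_rep[OF ext_deg_smult[OF that]]
      by (simp add: ext_class_smult[symmetric])
    then show ?thesis by (simp add: ext_class_eq_iff)
  qed
  from assms show ?thesis
  proof (cases rule: bilinear_relations_cases)
    case (1 X X' Y)
    then have "wedge_lift N q r = (?r (X \<oplus>\<^bsub>ext_algebra N q\<^esub> X') - ?r X - ?r X') * ?r Y"
      by (simp add: wedge_lift_def linext.diff left_diff_distrib)
    with 1 show ?thesis using ext_ideal_mult_right[OF add] ext_rep(1) by simp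
  next
    case (2 X Y Y')
    then have "wedge_lift N q r = ?r X * (?r (Y \<oplus>\<^bsub>ext_algebra N q\<^esub> Y') - ?r Y - ?r Y')"
      by (simp add: wedge_lift_def linext.diff right_diff_distrib)
    with 2 show ?thesis using ext_ideal_mult_left[OF add] ext_rep(1) by simp
  next
    case (3 s X Y)
    then have "wedge_lift N q r = (?r (ext_smult N q s X) - pscale s (?r X)) * ?r Y"
      by (simp add: wedge_lift_def linext.diff left_diff_distrib pscale_mult_left)
    with 3 show ?thesis using ext_ideal_mult_right[OF scale] ext_rep(1) by simp
  next
    case (4 s X Y)
    then have "wedge_lift N q r = ?r X * (?r (ext_smult N q s Y) - pscale s (?r Y))"
      by (simp add: wedge_lift_def linext.diff right_diff_distrib pscale_mult_right)
    with 4 show ?thesis using ext_ideal_mult_left[OF scale] ext_rep(1) by simp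
  qed
qed

lemma wedge_lift_span:
  assumes "\<phi> \<in> pscale.span (bilinear_relations N q i j)"
  shows "wedge_lift N q \<phi> \<in> ext_ideal N q"
proof -
  have "pscale.span (bilinear_relations N q i j) \<subseteq> {\<phi>. wedge_lift N q \<phi> \<in> ext_ideal N q}"
  proof (rule pscale.span_minimal)
    show "pscale.subspace {\<phi>. wedge_lift N q \<phi> \<in> ext_ideal N q}"
      by (rule pscale.subspaceI)
        (auto simp: wedge_lift_def linext.add linext.scale linext.zero
          intro: ext_ideal_zero ext_ideal_add ext_ideal_pscale)
  qed (auto intro: wedge_lift_relation)
  with assms show ?thesis by blast
qed

lemma tensor_class_self:
  "Poly_Mapping.keys \<phi> \<subseteq> ext_deg N q i \<times> ext_deg N q j \<Longrightarrow> \<phi> \<in> tensor_class N q i j \<phi>"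
  by (simp add: tensor_class_def pscale.span_zero)

lemma tensor_class_eqI:
  assumes "\<phi> - \<psi> \<in> pscale.span (bilinear_relations N q i j)"
  shows "tensor_class N q i j \<phi> = tensor_class N q i j \<psi>"
proof -
  have "\<phi> - \<chi> \<in> pscale.span (bilinear_relations N q i j)
    \<longleftrightarrow> \<psi> - \<chi> \<in> pscale.span (bilinear_relations N q i j)" for \<chi>
    using pscale.span_add[OF assms, of "\<psi> - \<chi>"] pscale.span_diff[OF _ assms, of "\<phi> - \<chi>"] by auto
  then show ?thesis by (simp add: tensor_class_def)
qed

text \<open>How a map defined on classes by \<open>the_elem\<close> of an image is evaluated:
  independence of the representative makes the image a singleton.\<close>

lemma the_elem_image_const:
  assumes "a \<in> A" "\<And>x. x \<in> A \<Longrightarrow> f x = c"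
  shows "the_elem (f ` A) = c"
proof -
  have "f ` A = {c}" using assms by blast
  then show ?thesis by simp
qed

lemma wedge_map_class:
  assumes "Poly_Mapping.keys \<phi> \<subseteq> ext_deg N q i \<times> ext_deg N q j"
  shows "wedge_map N q (tensor_class N q i j \<phi>) = ext_class N q (wedge_lift N q \<phi>)"
proof -
  let ?f = "\<lambda>\<phi>. finsum (ext_algebra N q)
        (\<lambda>(X, Y). ext_smult N q (Poly_Mapping.lookup \<phi> (X, Y)) (X \<otimes>\<^bsub>ext_algebra N q\<^esub> Y))
        (Poly_Mapping.keys \<phi>)"
  have "?f \<psi> = ?f \<phi>" if "\<psi> \<in> tensor_class N q i j \<phi>" for \<psi>
  proof -
    from that have \<psi>: "Poly_Mapping.keys \<psi> \<subseteq> ext_deg N q i \<times> ext_deg N q j"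
      and "\<phi> - \<psi> \<in> pscale.span (bilinear_relations N q i j)"
      by (auto simp: tensor_class_def)
    then have "wedge_lift N q (\<phi> - \<psi>) \<in> ext_ideal N q" by (intro wedge_lift_span)
    then have "ext_class N q (wedge_lift N q \<phi>) = ext_class N q (wedge_lift N q \<psi>)"
      by (simp add: ext_class_eq_iff wedge_lift_def linext.diff)
    then show ?thesis by (simp only: wedge_lift_finsum[OF \<psi>] wedge_lift_finsum[OF assms])
  qed
  with tensor_class_self[OF assms] have "wedge_map N q (tensor_class N q i j \<phi>) = ?f \<phi>"
    unfolding wedge_map_def by (rule the_elem_image_const)
  then show ?thesis by (simp only: wedge_lift_finsum[OF assms])
qed

section \<open>Tensor products of linear maps\<close>

definition ext_linear :: "nat \<Rightarrow> complex \<Rightarrow> nat \<Rightarrow> (tensor set \<Rightarrow> tensor set) \<Rightarrow> bool" where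
  "ext_linear N q m f \<longleftrightarrow> f \<in> ext_deg N q m \<rightarrow> ext_deg N q m
    \<and> (\<forall>X\<in>ext_deg N q m. \<forall>Y\<in>ext_deg N q m.
          f (X \<oplus>\<^bsub>ext_algebra N q\<^esub> Y) = f X \<oplus>\<^bsub>ext_algebra N q\<^esub> f Y)
    \<and> (\<forall>s. \<forall>X\<in>ext_deg N q m. f (ext_smult N q s X) = ext_smult N q s (f X))"

definition tensor_lift :: "(tensor set \<Rightarrow> tensor set) \<Rightarrow> (tensor set \<Rightarrow> tensor set) \<Rightarrow> formal \<Rightarrow> formal" where
  "tensor_lift f g = linext (\<lambda>(X, Y). Poly_Mapping.single (f X, g Y) 1)"

lemma tensor_lift_single:
  "tensor_lift f g (Poly_Mapping.single (X, Y) s) = Poly_Mapping.single (f X, g Y) s"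
  by (simp add: tensor_lift_def)

lemma tensor_lift_diff: "tensor_lift f g (\<phi> - \<psi>) = tensor_lift f g \<phi> - tensor_lift f g \<psi>"
  by (simp add: tensor_lift_def linext.diff)

text \<open>Linearity of \<open>f\<close> and \<open>g\<close> turns each bilinearity relation into
  a relation of the same shape, so the tensor product of the maps descends to classes.\<close>

lemma tensor_lift_relation:
  assumes f: "ext_linear N q i f" and g: "ext_linear N q j g"
    and r: "r \<in> bilinear_relations N q i j"
  shows "tensor_lift f g r \<in> bilinear_relations N q i j"
proof -
  have fX: "f X \<in> ext_deg N q i" if "X \<in> ext_deg N q i" for X
    using f that by (auto simp: ext_linear_def)
  have gY: "g Y \<in> ext_deg N q j" if "Y \<in> ext_deg N q j" for Y
    using g that by (auto simp: ext_linear_def)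
  from r show ?thesis
  proof (cases rule: bilinear_relations_cases)
    case (1 X X' Y)
    then have "tensor_lift f g r = Poly_Mapping.single (f X \<oplus>\<^bsub>ext_algebra N q\<^esub> f X', g Y) 1
        - Poly_Mapping.single (f X, g Y) 1 - Poly_Mapping.single (f X', g Y) 1"
      using f by (simp add: tensor_lift_diff tensor_lift_single ext_linear_def)
    then show ?thesis
      by (simp only: bilinear_relations_add_left[OF fX[OF 1(1)] fX[OF 1(2)] gY[OF 1(3)]])
  next
    case (2 X Y Y')
    then have "tensor_lift f g r = Poly_Mapping.single (f X, g Y \<oplus>\<^bsub>ext_algebra N q\<^esub> g Y') 1
        - Poly_Mapping.single (f X, g Y) 1 - Poly_Mapping.single (f X, g Y') 1"
      using g by (simp add: tensor_lift_diff tensor_lift_single ext_linear_def)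
    then show ?thesis
      by (simp only: bilinear_relations_add_right[OF fX[OF 2(1)] gY[OF 2(2)] gY[OF 2(3)]])
  next
    case (3 s X Y)
    then have "tensor_lift f g r
        = Poly_Mapping.single (ext_smult N q s (f X), g Y) 1 - Poly_Mapping.single (f X, g Y) s"
      using f by (simp add: tensor_lift_diff tensor_lift_single ext_linear_def)
    then show ?thesis
      by (simp only: bilinear_relations_smult_left[OF fX[OF 3(1)] gY[OF 3(2)]])
  next
    case (4 s X Y)
    then have "tensor_lift f g r
        = Poly_Mapping.single (f X, ext_smult N q s (g Y)) 1 - Poly_Mapping.single (f X, g Y) s"
      using g by (simp add: tensor_lift_diff tensor_lift_single ext_linear_def)
    then show ?thesis
      by (simp only: bilinear_relations_smult_right[OF fX[OF 4(1)] gY[OF 4(2)]])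
  qed
qed

lemma tensor_lift_span:
  assumes "ext_linear N q i f" "ext_linear N q j g"
    and "\<phi> \<in> pscale.span (bilinear_relations N q i j)"
  shows "tensor_lift f g \<phi> \<in> pscale.span (bilinear_relations N q i j)"
proof -
  have "tensor_lift f g ` pscale.span (bilinear_relations N q i j)
      = pscale.span (tensor_lift f g ` bilinear_relations N q i j)"
    unfolding tensor_lift_def by (rule linext.span_image[symmetric])
  also have "\<dots> \<subseteq> pscale.span (bilinear_relations N q i j)"
    using tensor_lift_relation[OF assms(1,2)] by (intro pscale.span_mono) blast
  finally show ?thesis using assms(3) by blast
qed

lemma tensor_map_class:
  assumes "ext_linear N q i f" "ext_linear N q j g"
    and "Poly_Mapping.keys \<phi> \<subseteq> ext_deg N q i \<times> ext_deg N q j"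
  shows "tensor_map N q i j f g (tensor_class N q i j \<phi>) = tensor_class N q i j (tensor_lift f g \<phi>)"
proof -
  have *: "(\<Sum>(X, Y)\<in>Poly_Mapping.keys \<psi>.
          Poly_Mapping.single (f X, g Y) (Poly_Mapping.lookup \<psi> (X, Y))) = tensor_lift f g \<psi>" for \<psi>
    by (simp add: tensor_lift_def linext_def case_prod_beta)
  have "tensor_class N q i j (tensor_lift f g \<psi>) = tensor_class N q i j (tensor_lift f g \<phi>)"
    if "\<psi> \<in> tensor_class N q i j \<phi>" for \<psi>
  proof (rule tensor_class_eqI[symmetric])
    from that have "\<phi> - \<psi> \<in> pscale.span (bilinear_relations N q i j)"
      by (simp add: tensor_class_def)
    then show "tensor_lift f g \<phi> - tensor_lift f g \<psi> \<in> pscale.span (bilinear_relations N q i j)"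
      using tensor_lift_span[OF assms(1,2)] by (simp add: tensor_lift_diff[symmetric])
  qed
  with tensor_class_self[OF assms(3)] show ?thesis
    unfolding tensor_map_def * by (rule the_elem_image_const)
qed

lemma ext_linear_id: "ext_linear N q m (ext_id N q m)"
  by (simp add: ext_linear_def ext_id_def ext_deg_add ext_deg_smult)

section \<open>Endomorphisms of the component of degree one\<close>

lemma embed_V_deg: "(\<Sum>i\<le>N. Poly_Mapping.single [i] (v $ i)) \<in> tensor_deg N 1"
  by (intro tensor_deg_sum tensor_deg_single) auto

lemma lookup_letters:
  "k \<le> N \<Longrightarrow> Poly_Mapping.lookup (\<Sum>i\<le>(N::nat). Poly_Mapping.single [i] (c i)) [k] = (c k :: complex)"
  by (simp add: lookup_sum lookup_single when_def)

text \<open>Words of length one are already straight, so equal classes force equal coefficients.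
  This makes \<open>the_inv_into\<close> in \<open>ext_end1\<close> a genuine inverse.\<close>

lemma embed_V_inj: 
  assumes "q \<noteq> 0"
  shows "inj_on (embed_V N q) (carrier_vec (N + 1))"
proof (rule inj_onI)
  fix v w :: "complex vec"
  assume vw: "v \<in> carrier_vec (N + 1)" "w \<in> carrier_vec (N + 1)" "embed_V N q v = embed_V N q w"
  have normal: "straighten q (\<Sum>i\<le>N. Poly_Mapping.single [i] (u $ i)) = (\<Sum>i\<le>N. Poly_Mapping.single [i] (u $ i))" for u
    by (simp add: straighten_sum straighten_single word_sign_def)
  have "(\<Sum>i\<le>N. Poly_Mapping.single [i] (v $ i)) = (\<Sum>i\<le>N. Poly_Mapping.single [i] (w $ i))"
    using vw(3) assms
    by (simp add: embed_V_def ext_class_eq_straighten tensor_deg_carrier[OF embed_V_deg] normal)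
  then have "v $ k = w $ k" if "k \<le> N" for k
    using lookup_letters[OF that, of "($) v"] lookup_letters[OF that, of "($) w"] by simp
  then show "v = w" using vw by (intro eq_vecI) auto
qed

lemma ext_deg_1: "ext_deg N q 1 = embed_V N q ` carrier_vec (N + 1)"
proof
  show "embed_V N q ` carrier_vec (N + 1) \<subseteq> ext_deg N q 1"
    using embed_V_deg by (auto simp: embed_V_def ext_deg_def)
  show "ext_deg N q 1 \<subseteq> embed_V N q ` carrier_vec (N + 1)"
  proof
    fix X assume "X \<in> ext_deg N q 1"
    then obtain x where x: "x \<in> tensor_deg N 1" "X = ext_class N q x" by (auto simp: ext_deg_def)
    let ?v = "vec (N + 1) (\<lambda>i. Poly_Mapping.lookup x [i])"
    have "Poly_Mapping.keys x \<subseteq> (\<lambda>i. [i]) ` {..N}"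
    proof
      fix w assume "w \<in> Poly_Mapping.keys x"
      with x have "length w = 1" "set w \<subseteq> {..N}" by (auto simp: tensor_deg_def)
      then show "w \<in> (\<lambda>i. [i]) ` {..N}" by (auto simp: length_Suc_conv)
    qed
    then have "x = (\<Sum>w\<in>(\<lambda>i. [i]) ` {..N}. Poly_Mapping.single w (Poly_Mapping.lookup x w))"
      using linext_superset[of "(\<lambda>i. [i]) ` {..N}" x "\<lambda>w. Poly_Mapping.single w 1"] by (simp add: linext_id)
    also have "\<dots> = (\<Sum>i\<le>N. Poly_Mapping.single [i] (?v $ i))"
      by (subst sum.reindex) (auto simp: inj_on_def)
    finally have "X = embed_V N q ?v" using x(2) by (simp only: embed_V_def)
    then show "X \<in> embed_V N q ` carrier_vec (N + 1)"
      by (rule image_eqI) (rule vec_carrier)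
  qed
qed

lemma embed_V_add:
  assumes "v \<in> carrier_vec (N + 1)" "w \<in> carrier_vec (N + 1)"
  shows "embed_V N q v \<oplus>\<^bsub>ext_algebra N q\<^esub> embed_V N q w = embed_V N q (v + w)"
  using assms
  by (simp add: embed_V_def ext_class_add tensor_deg_carrier[OF embed_V_deg] sum.distrib[symmetric] single_add[symmetric])

lemma embed_V_smult:
  assumes "v \<in> carrier_vec (N + 1)"
  shows "ext_smult N q s (embed_V N q v) = embed_V N q (s \<cdot>\<^sub>v v)"
  using assms
  by (simp add: embed_V_def ext_class_smult tensor_deg_carrier[OF embed_V_deg] pscale.scale_sum_right)

lemma ext_end1_embed:
  assumes "q \<noteq> 0" "v \<in> carrier_vec (N + 1)"
  shows "ext_end1 N q A (embed_V N q v) = embed_V N q (A *\<^sub>v v)"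
proof -
  have "embed_V N q v \<in> ext_deg N q 1"
    using assms(2) unfolding ext_deg_1 by blast
  then show ?thesis
    by (simp only: ext_end1_def restrict_apply' the_inv_into_f_f[OF embed_V_inj[OF assms(1)] assms(2)])
qed

lemma ext_linear_end1:
  assumes "q \<noteq> 0" "A \<in> carrier_mat (N + 1) (N + 1)"
  shows "ext_linear N q 1 (ext_end1 N q A)"
  unfolding ext_linear_def ext_deg_1
  using assms
  by (auto simp: ext_end1_embed embed_V_add embed_V_smult mult_add_distrib_mat_vec mult_mat_vec
      intro!: imageI mult_mat_vec_carrier)

text \<open>A letter is the class of a unit vector, whose image is a column of
  \<open>A\<close>.\<close>

lemma ext_end1_letter:
  assumes "q \<noteq> 0" "A \<in> carrier_mat (N + 1) (N + 1)" "k \<le> N"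
  shows "ext_end1 N q A (ext_word N q [k]) = ext_class N q (\<Sum>l\<le>N. Poly_Mapping.single [l] (A $$ (l, k)))"
proof -
  have "(\<Sum>i\<le>N. Poly_Mapping.single [i] (unit_vec (N + 1) k $ i)) = (\<Sum>i\<le>N. if i = k then Poly_Mapping.single [i] (1::complex) else 0)"
    using assms by (intro sum.cong) (auto simp: index_unit_vec)
  then have "ext_word N q [k] = embed_V N q (unit_vec (N + 1) k)"
    using assms by (simp add: ext_word_def embed_V_def)
  moreover have "(\<Sum>l\<le>N. Poly_Mapping.single [l] ((A *\<^sub>v unit_vec (N + 1) k) $ l))
      = (\<Sum>l\<le>N. Poly_Mapping.single [l] (A $$ (l, k)))"
    using assms by (intro sum.cong) auto
  ultimately show ?thesis
    using ext_end1_embed[OF assms(1), of "unit_vec (N + 1) k"] by (simp only: embed_V_def unit_vec_carrier)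
qed

section \<open>Shuffles of one letter into the others\<close>

text \<open>The cycle 0, k, k - 1, ..., 1. As a shuffle of one letter with the others, it puts
  \<open>k\<close> first and lists the remaining values in increasing order.\<close>

definition insertion_perm :: "nat \<Rightarrow> nat \<Rightarrow> nat" where
  "insertion_perm k a = (if a = 0 then k else if a \<le> k then a - 1 else a)"

text \<open>The second tensor factor left when the letter \<open>k\<close> is split off from the top
  word.\<close>

definition omit_word :: "nat \<Rightarrow> nat \<Rightarrow> nat list" where
  "omit_word N k = [0..<k] @ [Suc k..<Suc N]"

lemma set_omit_word: "k \<le> N \<Longrightarrow> set (omit_word N k) = {..N} - {k}"
  by (auto simp: omit_word_def)

lemma length_omit_word: "k \<le> N \<Longrightarrow> length (omit_word N k) = N"
  by (simp add: omit_word_def)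

lemma sorted_omit_word: "sorted_wrt (<) (omit_word N k)"
  by (auto simp: omit_word_def sorted_wrt_append)

lemma map_insertion_perm:
  assumes "k \<le> N"
  shows "map (insertion_perm k) [1..<1 + N] = omit_word N k"
proof (rule nth_equalityI)
  show "length (map (insertion_perm k) [1..<1 + N]) = length (omit_word N k)"
    using assms by (simp add: length_omit_word del: upt_Suc)
  fix i assume "i < length (map (insertion_perm k) [1..<1 + N])"
  then have "i < N" by (simp del: upt_Suc)
  then show "map (insertion_perm k) [1..<1 + N] ! i = omit_word N k ! i"
    using assms by (cases "i < k") (simp_all add: omit_word_def insertion_perm_def nth_append del: upt_Suc)
qed

lemma insertion_perm_shuffle:
  assumes "k \<le> N"
  shows "insertion_perm k \<in> shuffle_perms 1 N"
proof -
  have "insertion_perm k permutes {..<1 + N}"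
  proof (rule inj_imp_permutes)
    show "inj_on (insertion_perm k) {..<1 + N}"
      by (auto simp: inj_on_def insertion_perm_def split: if_splits)
  qed (use assms in \<open>auto simp: insertion_perm_def split: if_splits\<close>)
  moreover have "strict_mono_on {1..<1 + N} (insertion_perm k)"
    by (auto simp: strict_mono_on_def insertion_perm_def)
  ultimately show ?thesis
    by (auto simp: shuffle_perms_def strict_mono_on_def)
qed

text \<open>A shuffle \<open>w\<close> of one letter with the others is determined by
  \<open>w 0\<close>: the remaining values form the complement of \<open>w 0\<close>, and a set has
  only one strictly increasing enumeration.\<close>

lemma shuffle_perms_1: "shuffle_perms 1 N = insertion_perm ` {..N}"
proof
  show "insertion_perm ` {..N} \<subseteq> shuffle_perms 1 N"
    using insertion_perm_shuffle by blast
  show "shuffle_perms 1 N \<subseteq> insertion_perm ` {..N}"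
  proof
    fix w assume "w \<in> shuffle_perms 1 N"
    then have w: "w permutes {..<1 + N}" "strict_mono_on {1..<1 + N} w"
      by (auto simp: shuffle_perms_def)
    let ?k = "w 0"
    have k: "?k \<le> N" using permutes_in_image[OF w(1), of 0] by simp
    have "w ` {1..<1 + N} = w ` ({..<1 + N} - {0})"
      by (rule arg_cong[of _ _ "(`) w"]) auto
    also have "\<dots> = w ` {..<1 + N} - w ` {0}"
      using permutes_inj[OF w(1)] by (rule image_set_diff)
    also have "\<dots> = {..N} - {?k}"
      using permutes_image[OF w(1)] by auto
    finally have "set (map w [1..<1 + N]) = set (omit_word N ?k)"
      using k by (simp add: set_omit_word del: upt_Suc)
    moreover have "sorted_wrt (<) (map w [1..<1 + N])"
      using w(2) by (auto simp: sorted_wrt_iff_nth_less strict_mono_on_def simp del: upt_Suc)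
    ultimately have "map w [1..<1 + N] = map (insertion_perm ?k) [1..<1 + N]"
      using sorted_omit_word k unfolding map_insertion_perm[OF k]
      by (intro strict_sorted_equal) auto
    then have eq: "w a = insertion_perm ?k a" if "1 \<le> a" "a < 1 + N" for a
      using that by (auto simp del: upt_Suc)
    have "w a = insertion_perm ?k a" for a
    proof -
      consider "a = 0" | "1 \<le> a" "a < 1 + N" | "1 + N \<le> a" by linarith
      then show ?thesis
      proof cases
        \<comment> \<open>Beyond position \<open>N\<close> both maps are the identity:
          \<open>w\<close> by \<open>permutes\<close>, the other because its cycle ends at
          \<open>w 0\<close>, which is at most \<open>N\<close>.\<close>
        case 3
        then show ?thesis
          using permutes_not_in[OF w(1), of a] k by (simp add: insertion_perm_def)
      qed (use eq in \<open>auto simp: insertion_perm_def\<close>)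
    qed
    then have "w = insertion_perm ?k" by (rule ext)
    then show "w \<in> insertion_perm ` {..N}" using k by (intro image_eqI[of _ _ ?k]) auto
  qed
qed

lemma inj_insertion_perm: "inj insertion_perm"
proof (rule injI)
  fix k l assume "insertion_perm k = insertion_perm l"
  then have "insertion_perm k 0 = insertion_perm l 0" by simp
  then show "k = l" by (simp add: insertion_perm_def)
qed

text \<open>All inversions involve position 0, paired with the positions 1 to
  \<open>k\<close>.\<close>

lemma perm_length_insertion:
  assumes "k \<le> N"
  shows "perm_length (1 + N) (insertion_perm k) = k"
proof -
  have "{(a, b). a < b \<and> b < 1 + N \<and> insertion_perm k b < insertion_perm k a} = Pair 0 ` {1..k}"
    using assms by (auto simp: insertion_perm_def split: if_splits)
  then show ?thesis by (simp add: perm_length_def card_image inj_on_def)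
qed

section \<open>The top component\<close>

text \<open>By counting, an increasing word with \<open>N + 1\<close> letters uses the whole
  alphabet. Hence the top component has dimension at most one.\<close>

lemma basis_words_top: "basis_words N (N + 1) = {[0..<N + 1]}"
proof -
  have "w = [0..<N + 1]" if "w \<in> basis_words N (N + 1)" for w
  proof -
    from that have w: "length w = N + 1" "set w \<subseteq> {..N}" "sorted_wrt (<) w"
      by (auto simp: basis_words_def)
    then have "card (set w) = card {..N}" by (simp add: distinct_card strict_sorted_iff)
    with w(2) have "set w = {..N}" by (intro card_subset_eq) auto
    with w(3) show ?thesis by (intro strict_sorted_equal) (auto simp del: upt_Suc)
  qed
  then show ?thesis by (auto simp: basis_words_def simp del: upt_Suc)
qed

lemma straighten_top:
  assumes "x \<in> tensor_deg N (N + 1)"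
  obtains s where "straighten q x = Poly_Mapping.single [0..<N + 1] s"
proof -
  have keys: "Poly_Mapping.keys (straighten q x) \<subseteq> {[0..<N + 1]}"
    using keys_straighten[OF assms] by (simp only: basis_words_top)
  have "straighten q x = Poly_Mapping.single [0..<N + 1] (Poly_Mapping.lookup (straighten q x) [0..<N + 1])"
    using linext_superset[OF _ keys, of "\<lambda>w. Poly_Mapping.single w 1"] by (simp add: linext_id del: upt_Suc)
  then show thesis by (rule that)
qed

text \<open>A letter other than \<open>k\<close> already occurs in the word and gives 0. The letter
  \<open>k\<close> has to pass the \<open>k\<close> smaller letters, each at the cost of a factor
  \<open>- inverse q\<close>.\<close>

lemma straighten_insert_letter:
  assumes "k \<le> N" "l \<le> N"
  shows "straighten q (Poly_Mapping.single (l # omit_word N k) s)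
    = (if l = k then Poly_Mapping.single [0..<N + 1] (s * (- inverse q) ^ k) else 0)"
proof (cases "l = k")
  case True
  have "distinct (omit_word N k)" "sorted (omit_word N k)"
    using sorted_omit_word by (auto simp: strict_sorted_iff)
  note omit = this set_omit_word[OF assms(1)]
  have "length (filter (\<lambda>y. y < k) (omit_word N k)) = card ({y. y < k} \<inter> ({..N} - {k}))"
    using omit by (simp add: distinct_length_filter)
  also have "{y. y < k} \<inter> ({..N} - {k}) = {..<k}" using assms by auto
  finally have "word_inversions (k # omit_word N k) = k"
    using omit by (simp add: word_inversions_sorted)
  moreover have "distinct (k # omit_word N k)" using omit by simp
  ultimately have sign: "word_sign q (k # omit_word N k) = (- inverse q) ^ k"
    by (simp add: word_sign_def)
  have "sort (k # omit_word N k) = [0..<N + 1]"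
  proof (rule strict_sorted_equal)
    show "sorted_wrt (<) (sort (k # omit_word N k))"
      using omit by (simp only: strict_sorted_iff sorted_sort distinct_sort) simp
    show "set (sort (k # omit_word N k)) = set [0..<N + 1]"
    proof -
      have "insert k ({..N} - {k}) = {0..<N + 1}" using assms by auto
      then show ?thesis by (simp only: set_sort set_upt list.set(2) omit(3))
    qed
  qed (simp del: upt_Suc)
  with sign True show ?thesis by (simp add: straighten_single del: upt_Suc sort_key_simps)
next
  case False
  then show ?thesis
    using assms by (simp add: straighten_single word_sign_def set_omit_word)
qed

section \<open>The q-trace\<close>

text \<open>The two powers are kept apart by origin: the first is the coefficient of the shuffle in
  the coproduct, the second comes from moving the letter back to its place.\<close>

definition diag_trace :: "nat \<Rightarrow> complex \<Rightarrow> complex mat \<Rightarrow> complex" where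
  "diag_trace N q A = (\<Sum>k\<le>N. (- q) powi (- int k) * (- inverse q) ^ k * A $$ (k, k))"

lemma keys_sum_single_subset:
  assumes "\<And>k. k \<in> S \<Longrightarrow> p k \<in> B"
  shows "Poly_Mapping.keys (\<Sum>k\<in>S. Poly_Mapping.single (p k) (c k :: complex)) \<subseteq> B"
  using Poly_Mapping.keys_sum[of "\<lambda>k. Poly_Mapping.single (p k) (c k)" S] assms
  by (auto split: if_splits)

lemma sum_single: "(\<Sum>k\<in>S. Poly_Mapping.single w (c k)) = Poly_Mapping.single w (sum c S)"
  by (induction S rule: infinite_finite_induct) (simp_all add: single_add)

lemma ext_class_sum_cong:
  assumes "\<And>k. k \<in> S \<Longrightarrow> ext_class N q (x k) = ext_class N q (y k)"
  shows "ext_class N q (\<Sum>k\<in>S. pscale (c k) (x k)) = ext_class N q (\<Sum>k\<in>S. pscale (c k) (y k))"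
proof -
  have "(\<Sum>k\<in>S. pscale (c k) (x k)) - (\<Sum>k\<in>S. pscale (c k) (y k)) = (\<Sum>k\<in>S. pscale (c k) (x k - y k))"
    by (simp add: sum_subtractf pscale.scale_right_diff_distrib)
  also have "\<dots> \<in> ext_ideal N q"
    using assms by (intro ext_ideal_sum ext_ideal_pscale) (simp add: ext_class_eq_iff)
  finally show ?thesis by (simp add: ext_class_eq_iff)
qed

lemma coproduct_top:
  assumes "q \<noteq> 0" "x \<in> tensor_deg N (N + 1)" "straighten q x = Poly_Mapping.single [0..<N + 1] s"
  shows "coproduct N q 1 N (ext_class N q x) = tensor_class N q 1 N
    (\<Sum>k\<le>N. Poly_Mapping.single (ext_word N q [k], ext_word N q (omit_word N k))
      (s * (- q) powi (- int k)))"
proof -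
  let ?v = "[0..<N + 1]"
  let ?t = "\<lambda>w v c. Poly_Mapping.single
           (ext_word N q (map (\<lambda>a. v ! w a) [0..<1]), ext_word N q (map (\<lambda>a. v ! w a) [1..<1 + N]))
           (c * (- q) powi (- int (perm_length (1 + N) w)))"
  have "normal_form N q (1 + N) (ext_class N q x) = Poly_Mapping.single ?v s"
    using assms normal_form_ext_class[of q x N "N + 1"] by simp
  then have "coproduct N q 1 N (ext_class N q x) = tensor_class N q 1 N
    (\<Sum>v\<in>Poly_Mapping.keys (Poly_Mapping.single ?v s). \<Sum>w\<in>shuffle_perms 1 N.
      ?t w v (Poly_Mapping.lookup (Poly_Mapping.single ?v s) v))"
    by (simp only: coproduct_def Let_def)
  also have "(\<Sum>v\<in>Poly_Mapping.keys (Poly_Mapping.single ?v s). \<Sum>w\<in>shuffle_perms 1 N.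
      ?t w v (Poly_Mapping.lookup (Poly_Mapping.single ?v s) v)) = (\<Sum>w\<in>shuffle_perms 1 N. ?t w ?v s)"
    \<comment> \<open>If \<open>s = 0\<close> the support on the left is empty, while on the right
      every term has coefficient 0.\<close>
    by (cases "s = 0") (simp_all del: upt_Suc)
  also have "\<dots> = (\<Sum>k\<le>N. ?t (insertion_perm k) ?v s)"
    unfolding shuffle_perms_1 by (rule sum.reindex[unfolded o_def]) (rule inj_on_subset[OF inj_insertion_perm], simp)
  also have "\<dots> = (\<Sum>k\<le>N. Poly_Mapping.single (ext_word N q [k], ext_word N q (omit_word N k))
      (s * (- q) powi (- int k)))"
  proof (rule sum.cong)
    fix k assume "k \<in> {..N}"
    then have k: "k \<le> N" by simp
    \<comment> \<open>The top word carries the letter \<open>a\<close> at position \<open>a\<close>,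
      so reading it through a permutation just lists the values of the permutation.\<close>
    have "map (\<lambda>a. ?v ! insertion_perm k a) [1..<1 + N] = map (insertion_perm k) [1..<1 + N]"
      by (rule map_cong) (auto simp: insertion_perm_def simp del: upt_Suc)
    then have "map (\<lambda>a. ?v ! insertion_perm k a) [1..<1 + N] = omit_word N k"
      by (simp only: map_insertion_perm[OF k])
    moreover have "map (\<lambda>a. ?v ! insertion_perm k a) [0..<1] = [k]"
    proof -
      have "map (\<lambda>a. ?v ! insertion_perm k a) [0..<1] = [?v ! insertion_perm k 0]" by simp
      also have "?v ! insertion_perm k 0 = k"
        using k by (simp add: insertion_perm_def del: upt_Suc)
      finally show ?thesis .
    qed
    ultimately show "?t (insertion_perm k) ?v s = Poly_Mapping.single
        (ext_word N q [k], ext_word N q (omit_word N k)) (s * (- q) powi (- int k))"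
      by (simp only: perm_length_insertion[OF k])
  qed simp
  finally show ?thesis .
qed

lemma convolution_top:
  assumes "q \<noteq> 0" "A \<in> carrier_mat (N + 1) (N + 1)" "x \<in> tensor_deg N (N + 1)"
  shows "convolution N q 1 N (ext_end1 N q A) (ext_id N q N) (ext_class N q x)
    = ext_smult N q (diag_trace N q A) (ext_class N q x)"
proof -
  let ?f = "ext_end1 N q A" and ?g = "ext_id N q N" and ?r = "ext_rep N q"
  obtain s where s: "straighten q x = Poly_Mapping.single [0..<N + 1] s"
    using straighten_top[OF assms(3)] .
  \<comment> \<open>For the letter \<open>k\<close> split off: its coefficient in the coproduct, the
    column of \<open>A\<close> replacing it, and the complementary word.\<close>
  define c where "c k = s * (- q) powi (- int k)" for k :: nat
  define e where "e k = (\<Sum>l\<le>N. Poly_Mapping.single [l] (A $$ (l, k)))" for k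
  define o' where "o' k = Poly_Mapping.single (omit_word N k) (1 :: complex)" for k
  have deg: "ext_word N q [k] \<in> ext_deg N q 1" "ext_word N q (omit_word N k) \<in> ext_deg N q N"
    if "k \<le> N" for k
    using that by (auto intro!: ext_word_deg simp: length_omit_word set_omit_word)
  have carrier: "e k \<in> carrier (tensor_algebra N)" "o' k \<in> carrier (tensor_algebra N)" if "k \<le> N" for k
    using that by (auto simp: e_def o'_def set_omit_word intro!: tensor_carrier_sum tensor_carrier_single)
  have f: "?f (ext_word N q [k]) = ext_class N q (e k)" if "k \<le> N" for k
    using ext_end1_letter[OF assms(1,2) that] by (simp add: e_def)
  have g: "?g (ext_word N q (omit_word N k)) = ext_class N q (o' k)" if "k \<le> N" for k
    using deg[OF that] by (simp add: ext_id_def ext_word_def o'_def)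
  have fdeg: "ext_class N q (e k) \<in> ext_deg N q 1" "ext_class N q (o' k) \<in> ext_deg N q N" if "k \<le> N" for k
    using ext_linear_end1[OF assms(1,2)] ext_linear_id[of N q N] deg[OF that] f[OF that] g[OF that]
    by (auto simp: ext_linear_def Pi_iff dest!: bspec)
  let ?\<phi> = "\<Sum>k\<le>N. Poly_Mapping.single (ext_word N q [k], ext_word N q (omit_word N k)) (c k)"
  let ?\<psi> = "\<Sum>k\<le>N. Poly_Mapping.single (ext_class N q (e k), ext_class N q (o' k)) (c k)"
  have "tensor_lift ?f ?g ?\<phi> = ?\<psi>"
    unfolding tensor_lift_def linext.sum by (intro sum.cong refl) (simp add: f g)
  moreover have "Poly_Mapping.keys ?\<phi> \<subseteq> ext_deg N q 1 \<times> ext_deg N q N"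
    by (rule keys_sum_single_subset) (use deg in auto)
  ultimately have "tensor_map N q 1 N ?f ?g (coproduct N q 1 N (ext_class N q x)) = tensor_class N q 1 N ?\<psi>"
    using coproduct_top[OF assms(1,3) s] tensor_map_class[OF ext_linear_end1[OF assms(1,2)] ext_linear_id]
    by (simp only: c_def)
  moreover have "Poly_Mapping.keys ?\<psi> \<subseteq> ext_deg N q 1 \<times> ext_deg N q N"
    by (rule keys_sum_single_subset) (use fdeg in auto)
  moreover have "ext_class N q x \<in> ext_deg N q (1 + N)"
    using assms(3) by (simp add: ext_deg_def)
  ultimately have "convolution N q 1 N ?f ?g (ext_class N q x) = ext_class N q (wedge_lift N q ?\<psi>)"
    by (simp only: convolution_def restrict_apply' wedge_map_class)
  also have "wedge_lift N q ?\<psi> = (\<Sum>k\<le>N. pscale (c k) (?r (ext_class N q (e k)) * ?r (ext_class N q (o' k))))"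
    by (simp add: wedge_lift_def linext.sum)
  \<comment> \<open>Returns from the chosen representatives to the explicit tensors, which is
    allowed inside a class.\<close>
  also have "ext_class N q \<dots> = ext_class N q (\<Sum>k\<le>N. pscale (c k) (e k * o' k))"
  proof (rule ext_class_sum_cong)
    fix k assume "k \<in> {..N}"
    then have k: "k \<le> N" by simp
    have "ext_class N q (?r (ext_class N q (e k)) * ?r (ext_class N q (o' k)))
      = ext_class N q (e k) \<otimes>\<^bsub>ext_algebra N q\<^esub> ext_class N q (o' k)"
      using ext_rep[OF fdeg(1)[OF k]] ext_rep[OF fdeg(2)[OF k]] by (simp add: ext_class_mult[symmetric])
    then show "ext_class N q (?r (ext_class N q (e k)) * ?r (ext_class N q (o' k))) = ext_class N q (e k * o' k)"
      using carrier[OF k] by (simp add: ext_class_mult)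
  qed
  also have "\<dots> = ext_class N q (pscale (diag_trace N q A) x)"
  proof -
    \<comment> \<open>Of the column of \<open>A\<close> only the diagonal entry survives, the other
      letters being repeated in the complementary word.\<close>
    have "straighten q (e k * o' k) = Poly_Mapping.single [0..<N + 1] ((- inverse q) ^ k * A $$ (k, k))"
      if "k \<le> N" for k
    proof -
      have "straighten q (e k * o' k) = (\<Sum>l\<le>N. straighten q (Poly_Mapping.single (l # omit_word N k) (A $$ (l, k))))"
        by (simp add: e_def o'_def sum_distrib_right single_word_mult straighten_sum)
      also have "\<dots> = (\<Sum>l\<le>N. if l = k then Poly_Mapping.single [0..<N + 1] (A $$ (k, k) * (- inverse q) ^ k) else 0)"
        using that by (intro sum.cong) (auto simp: straighten_insert_letter simp del: upt_Suc)
      finally show ?thesis using that by (simp add: mult.commute del: upt_Suc)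
    qed
    then have "straighten q (\<Sum>k\<le>N. pscale (c k) (e k * o' k))
      = (\<Sum>k\<le>N. Poly_Mapping.single [0..<N + 1] (c k * ((- inverse q) ^ k * A $$ (k, k))))"
      by (simp add: straighten_sum straighten_pscale del: upt_Suc)
    also have "\<dots> = Poly_Mapping.single [0..<N + 1] (diag_trace N q A * s)"
      unfolding diag_trace_def sum_distrib_right sum_single by (simp add: c_def ac_simps del: upt_Suc)
    also have "\<dots> = straighten q (pscale (diag_trace N q A) x)"
      by (simp add: straighten_pscale s del: upt_Suc)
    finally show ?thesis
      using tensor_deg_carrier[OF assms(3)] carrier
      by (subst ext_class_eq_straighten[OF assms(1)])
        (auto intro!: tensor_carrier_sum tensor_carrier_pscale tensor_carrier_mult)
  qed
  also have "\<dots> = ext_smult N q (diag_trace N q A) (ext_class N q x)"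
    using assms(3) by (simp add: ext_class_smult tensor_deg_carrier)
  finally show ?thesis .
qed

lemma q_trace_eq:
  assumes "q \<noteq> 0" "A \<in> carrier_mat (N + 1) (N + 1)"
  shows "q_trace N q A = diag_trace N q A"
  unfolding q_trace_def
proof (rule the_equality)
  show "convolution N q 1 N (ext_end1 N q A) (ext_id N q N)
    = (\<lambda>X\<in>ext_deg N q (N + 1). ext_smult N q (diag_trace N q A) (ext_id N q (N + 1) X))"
  proof
    fix X
    show "convolution N q 1 N (ext_end1 N q A) (ext_id N q N) X
      = (\<lambda>X\<in>ext_deg N q (N + 1). ext_smult N q (diag_trace N q A) (ext_id N q (N + 1) X)) X"
    proof (cases "X \<in> ext_deg N q (N + 1)")
      case True
      then obtain x where "x \<in> tensor_deg N (N + 1)" "X = ext_class N q x" by (auto simp: ext_deg_def)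
      with True convolution_top[OF assms] show ?thesis by (simp add: ext_id_def)
    next
      \<comment> \<open>Outside the top component both restricted functions have the value
        \<open>undefined\<close>.\<close>
      case False
      then show ?thesis by (simp add: convolution_def)
    qed
  qed
next
  fix t
  assume t: "convolution N q 1 N (ext_end1 N q A) (ext_id N q N)
    = (\<lambda>X\<in>ext_deg N q (N + 1). ext_smult N q t (ext_id N q (N + 1) X))"
  \<comment> \<open>Uniqueness is tested on the class of the top word. It is nonzero because this
    word is its own straightening, so the two scalars can be compared.\<close>
  let ?v = "[0..<N + 1]"
  let ?x = "Poly_Mapping.single ?v (1 :: complex)"
  have x: "?x \<in> tensor_deg N (N + 1)"
    by (rule tensor_deg_single) auto
  then have X: "ext_class N q ?x \<in> ext_deg N q (N + 1)" by (simp only: ext_deg_def imageI)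
  have "ext_smult N q (diag_trace N q A) (ext_class N q ?x) = ext_smult N q t (ext_class N q ?x)"
    using convolution_top[OF assms x] X unfolding t by (simp add: ext_id_def del: upt_Suc)
  then have "ext_class N q (pscale (diag_trace N q A) ?x) = ext_class N q (pscale t ?x)"
    by (simp only: ext_class_smult[OF tensor_deg_carrier[OF x]])
  then have "straighten q (pscale (diag_trace N q A) ?x) = straighten q (pscale t ?x)"
    using ext_class_eq_straighten[OF assms(1)] tensor_carrier_pscale[OF tensor_deg_carrier[OF x]]
    by blast
  moreover have "straighten q (Poly_Mapping.single ?v u) = Poly_Mapping.single ?v u" for u
    by (rule straighten_normal[of _ N "N + 1"]) (simp add: basis_words_top[unfolded Suc_eq_plus1[symmetric]] del: upt_Suc)
  ultimately have "Poly_Mapping.single ?v (diag_trace N q A) = Poly_Mapping.single ?v t"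
    by (simp only: pscale_single mult_1_right)
  then have "Poly_Mapping.lookup (Poly_Mapping.single ?v (diag_trace N q A)) ?v
      = Poly_Mapping.lookup (Poly_Mapping.single ?v t) ?v"
    by (rule arg_cong)
  then show "t = diag_trace N q A" by (simp only: lookup_single_eq)
qed

section \<open>The quantum trace\<close>

definition K_diag :: "complex \<Rightarrow> nat \<Rightarrow> nat \<Rightarrow> complex" where
  "K_diag q i l = (if l = i - 1 then q else if l = i then inverse q else 1)"

lemma rho_UK_append:
  "rho N q u = mat_diag (N + 1) f \<Longrightarrow>
    rho N q (replicate m (UK i) @ u) = mat_diag (N + 1) (\<lambda>l. K_diag q i l ^ m * f l)"
  by (induction m) (simp_all add: rho_def K_diag_def mult.assoc)

lemma rho_K_product:
  "rho N q (concat (map (\<lambda>i. replicate (e i) (UK i)) is))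
    = mat_diag (N + 1) (\<lambda>l. \<Prod>i\<leftarrow>is. K_diag q i l ^ e i)"
proof (induction "is")
  case Nil
  then show ?case by (simp add: rho_def)
next
  case (Cons i "is")
  from rho_UK_append[OF this] show ?case by simp
qed

text \<open>Only \<open>UK (l + 1)\<close> and \<open>UK l\<close> act nontrivially on the vector
  numbered \<open>l\<close>. Their total exponents (l + 1)(N - l) and -l(N + 1 - l) add up to N -
  2l.\<close>

lemma rho_K_elem:
  assumes "q \<noteq> 0"
  shows "rho N q (K_elem N) = mat_diag (N + 1) (\<lambda>l. q ^ (N - l) * inverse q ^ l)"
proof -
  have "(\<Prod>i\<leftarrow>[1..<N + 1]. K_diag q i l ^ (i * (N + 1 - i))) = q ^ (N - l) * inverse q ^ l" if l: "l \<le> N" for l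
  proof -
    have "(\<Prod>i\<leftarrow>[1..<N + 1]. K_diag q i l ^ (i * (N + 1 - i))) = (\<Prod>i\<in>{1..<N + 1}. K_diag q i l ^ (i * (N + 1 - i)))"
      by (subst prod.distinct_set_conv_list[symmetric]) (simp_all del: upt_Suc)
    also have "\<dots> = (\<Prod>i\<in>{1..<N + 1}. (if i = l + 1 then q ^ ((l + 1) * (N - l)) else 1)
        * (if i = l then inverse q ^ (l * (N + 1 - l)) else 1))"
      by (intro prod.cong refl) (auto simp: K_diag_def)
    also have "\<dots> = q ^ ((l + 1) * (N - l)) * inverse q ^ (l * (N + 1 - l))"
      \<comment> \<open>At the ends one of the two generators is absent from the product: for
        \<open>l = N\<close> the first exponent is 0, for \<open>l = 0\<close> the second.\<close>
      using l by (cases "l = N"; cases "l = 0") (auto simp: prod.distrib)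
    also have "\<dots> = q ^ (N - l) * inverse q ^ l"
    proof -
      \<comment> \<open>Replacing the truncated difference \<open>N - l\<close> by \<open>m\<close>
        gives the exponents (l + 1)m and l(m + 1), with common part lm that cancels.\<close>
      obtain m where m: "N = l + m" using l le_Suc_ex by blast
      have "q ^ ((l + 1) * m) * inverse q ^ (l * (m + 1)) = (q * inverse q) ^ (l * m) * (q ^ m * inverse q ^ l)"
        unfolding power_mult_distrib by (simp add: power_add algebra_simps)
      also have "q * inverse q = 1" using assms by simp
      finally show ?thesis using m by simp
    qed
    finally show ?thesis .
  qed
  then show ?thesis
    by (auto simp: K_elem_def rho_K_product mat_diag_def simp del: upt_Suc intro!: cong_mat)
qed

lemma quantum_trace_eq:
  assumes "q \<noteq> 0" "A \<in> carrier_mat (N + 1) (N + 1)"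
  shows "quantum_trace N q A = (\<Sum>k\<le>N. q ^ (N - k) * inverse q ^ k * A $$ (k, k))"
proof -
  have "rho N q (K_elem N) * A = mat (N + 1) (N + 1) (\<lambda>(i, j). q ^ (N - i) * inverse q ^ i * A $$ (i, j))"
    by (simp only: rho_K_elem[OF assms(1)] mat_diag_mult_left[OF assms(2)])
  then show ?thesis
    by (auto simp: quantum_trace_def mat_trace_def lessThan_Suc_atMost intro!: sum.cong)
qed

theorem theorem3p7:
  fixes N :: nat and q :: complex and A :: "complex mat"
  assumes "N \<ge> 1"
    and "q \<noteq> 0"
    and "\<forall>n::nat. n \<ge> 1 \<longrightarrow> q ^ n \<noteq> 1"
    and "A \<in> carrier_mat (N + 1) (N + 1)"
  shows "q_trace N q A = q powi (- int N) * quantum_trace N q A"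
proof -
  \<comment> \<open>The comparison is termwise: the two signs cancel, and -2k = -N + (N -
    2k).\<close>
  have "(- q) powi (- int k) * (- inverse q) ^ k = q powi (- int N) * (q ^ (N - k) * inverse q ^ k)"
    if k: "k \<le> N" for k
  proof -
    obtain m where m: "N = k + m" using k le_Suc_ex by blast
    have "(- q) powi (- int k) * (- inverse q) ^ k = (- inverse q) ^ k * (- inverse q) ^ k"
      by (simp only: power_int_minus power_int_of_nat power_inverse[symmetric] inverse_minus_eq)
    also have "\<dots> = inverse q ^ k * inverse q ^ k"
      by (simp only: power_mult_distrib[symmetric] minus_mult_minus)
    \<comment> \<open>A factor 1 with exponent N - k is inserted, so that its part in
      \<open>inverse q\<close> completes one of the powers to \<open>inverse q ^ N\<close>.\<close>
    also have "\<dots> = (inverse q * q) ^ m * (inverse q ^ k * inverse q ^ k)"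
      using assms(2) by simp
    also have "\<dots> = inverse q ^ N * (q ^ m * inverse q ^ k)"
      unfolding power_mult_distrib m by (simp only: power_add ac_simps)
    finally show ?thesis
      by (simp only: m power_int_minus power_int_of_nat power_inverse diff_add_inverse)
  qed
  then have "diag_trace N q A = q powi (- int N) * quantum_trace N q A"
    unfolding diag_trace_def quantum_trace_eq[OF assms(2,4)] sum_distrib_left
    by (intro sum.cong refl) (simp only: atMost_iff mult.assoc[symmetric])
  then show ?thesis by (simp only: q_trace_eq[OF assms(2,4)])
qed

end
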